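(* Any $(2n+1)$-dimensional cosymplectic JJ-algebra $(\mathfrak{J},\alpha,\omega)$ is in one-to-one correspondence with a symplectic JJ-algebra $(\mathfrak{h},\omega_{\mathfrak{h}},\mathrm{D})$ of dimension $2n$ equipped with an anti-derivation $\mathrm{D}$ satisfying $$\mathrm{D}^2(x)=0\quad\text{and}\quad \omega_{\mathfrak{h}}(\mathrm{D}(x),y)=\omega_{\mathfrak{h}}(x,\mathrm{D}(y))$$ for any $x,y\in\mathfrak{h}$.
   Context: All algebras are finite-dimensional over a field $\mathbb{K}$ of characteristic different from $2$ and $3$. A JJ-algebra (Jacobi-Jordan algebra) is a vector space $\mathfrak{J}$ with a commutative bilinear product $\cdot$ satisfying $x\cdot(y\cdot z)+y\cdot(z\cdot x)+z\cdot(x\cdot y)=0$ for all $x,y,z$. An anti-derivation of an algebra $(\mathfrak{h},\cdot)$ is a linear map $\mathrm{D}:\mathfrak{h}\to\mathfrak{h}$ with $\mathrm{D}(x\cdot y)=-\mathrm{D}(x)\cdot y-x\cdot\mathrm{D}(y)$ for all $x,y$. A symplectic JJ-algebra $(\mathfrak{h},\omega_{\mathfrak{h}})$ is a JJ-algebra with a skew-symmetric non-degenerate bilinear form $\omega_{\mathfrak{h}}$ satisfying $\omega_{\mathfrak{h}}(x\cdot y,z)+\omega_{\mathfrak{h}}(z\cdot x,y)+\omega_{\mathfrak{h}}(y\cdot z,x)=0$ for all $x,y,z\in\mathfrak{h}$. A cosymplectic JJ-algebra $(\mathfrak{J},\alpha,\omega)$ of dimension $2n+1$ is a JJ-algebra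 $(\mathfrak{J},\cdot)$ with a $1$-form (linear form) $\alpha$ and a skew-symmetric bilinear form $\omega$ such that $\alpha\wedge\omega^n\neq0$ (where $\omega^n$ is the $n$-fold wedge power of $\omega$), $\alpha(x\cdot y)=0$, and $\omega(x\cdot y,z)+\omega(z\cdot x,y)+\omega(y\cdot z,x)=0$ for all $x,y,z\in\mathfrak{J}$.
   Formalization: The converse direction and the bijection of isomorphism classes assume characteristic 0 or greater than n: if 0 < char K ≤ n, then ω^n = 0, so no cosymplectic algebra of dimension 2n+1 exists, while symplectic ones of dimension 2n with D = 0 do. *)

theory Defs
  imports "HOL-Analysis.Analysis" "HOL-Computational_Algebra.Computational_Algebra"
begin

text \<open>
  Vector spaces are carried by subspaces \<open>V\<close> of an ambient vector space given by a type and a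
  scalar multiplication; the maps and forms on \<open>V\<close> are HOL functions whose values outside \<open>V\<close>
  are irrelevant. The condition on finite generation is needed because \<^const>\<open>vector_space.dim\<close>
  is \<open>0\<close> on infinite-dimensional spaces.
\<close>

definition has_dim :: "('k::field \<Rightarrow> 'v::ab_group_add \<Rightarrow> 'v) \<Rightarrow> 'v set \<Rightarrow> nat \<Rightarrow> bool" where
  "has_dim s V d \<longleftrightarrow> vector_space s \<and> module.subspace s V \<and>
     (\<exists>B. finite B \<and> module.span s B = V) \<and> vector_space.dim s V = d"

definition linear_on ::
  "('k::field \<Rightarrow> 'v::ab_group_add \<Rightarrow> 'v) \<Rightarrow> ('k \<Rightarrow> 'w::ab_group_add \<Rightarrow> 'w) \<Rightarrow> 'v set \<Rightarrow> ('v \<Rightarrow> 'w) \<Rightarrow> bool"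
  where
  "linear_on s t V f \<longleftrightarrow>
     (\<forall>x\<in>V. \<forall>y\<in>V. f (x + y) = f x + f y) \<and> (\<forall>c. \<forall>x\<in>V. f (s c x) = t c (f x))"

definition bilinear_on ::
  "('k::field \<Rightarrow> 'v::ab_group_add \<Rightarrow> 'v) \<Rightarrow> ('k \<Rightarrow> 'w::ab_group_add \<Rightarrow> 'w) \<Rightarrow> 'v set \<Rightarrow> ('v \<Rightarrow> 'v \<Rightarrow> 'w) \<Rightarrow> bool"
  where
  "bilinear_on s t V f \<longleftrightarrow>
     (\<forall>x\<in>V. linear_on s t V (\<lambda>y. f x y)) \<and> (\<forall>y\<in>V. linear_on s t V (\<lambda>x. f x y))"


subsection \<open>Exterior forms\<close>

text \<open>
  A \<open>p\<close>-form is a function on lists of vectors of length \<open>p\<close>. The wedge product of a \<open>p\<close>-form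
  and a \<open>q\<close>-form is the signed sum over \<open>(p,q)\<close>-shuffles, which agrees with
  \<open>1/(p! q!)\<close> times the signed sum over all permutations but makes sense in every characteristic.
  The set \<open>A\<close> consists of the argument positions given to the first factor.
\<close>

definition wedge ::
  "nat \<Rightarrow> nat \<Rightarrow> ('v list \<Rightarrow> 'k::field) \<Rightarrow> ('v list \<Rightarrow> 'k) \<Rightarrow> 'v list \<Rightarrow> 'k" where
  "wedge p q a b = (\<lambda>vs. \<Sum>A | A \<subseteq> {..<p + q} \<and> card A = p.
     (-1) ^ card {(i, j). i \<in> A \<and> j \<in> {..<p + q} - A \<and> j < i} *
     a (nths vs A) * b (nths vs ({..<p + q} - A)))"

definition form1 :: "('v \<Rightarrow> 'k) \<Rightarrow> 'v list \<Rightarrow> 'k" where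
  "form1 a vs = a (vs ! 0)"

definition form2 :: "('v \<Rightarrow> 'v \<Rightarrow> 'k) \<Rightarrow> 'v list \<Rightarrow> 'k" where
  "form2 w vs = w (vs ! 0) (vs ! 1)"

text \<open>
  Since \<open>w\<^sup>n\<close> is \<open>n!\<close> times the Pfaffian form of \<open>w\<close>, it vanishes when \<open>0 < CHAR('k) \<le> n\<close>.
\<close>

fun wedge_power2 :: "('v list \<Rightarrow> 'k::field) \<Rightarrow> nat \<Rightarrow> 'v list \<Rightarrow> 'k" where
  "wedge_power2 w 0 = (\<lambda>vs. 1)"
| "wedge_power2 w (Suc n) = wedge 2 (2 * n) w (wedge_power2 w n)"


subsection \<open>Symplectic and cosymplectic JJ-algebras\<close>

record ('k, 'v) alg =
  scl :: "'k \<Rightarrow> 'v \<Rightarrow> 'v"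
  car :: "'v set"
  mul :: "'v \<Rightarrow> 'v \<Rightarrow> 'v"

record ('k, 'v) symp = "('k, 'v) alg" +
  sform :: "'v \<Rightarrow> 'v \<Rightarrow> 'k"
  der :: "'v \<Rightarrow> 'v"

record ('k, 'v) cosymp = "('k, 'v) alg" +
  alpha :: "'v \<Rightarrow> 'k"
  omega :: "'v \<Rightarrow> 'v \<Rightarrow> 'k"

locale jj_algebra =
  fixes d :: nat and A :: "('k::field, 'v::ab_group_add, 'z) alg_scheme"
  assumes has_dim: "has_dim (scl A) (car A) d"
    and mul_closed: "\<lbrakk>x \<in> car A; y \<in> car A\<rbrakk> \<Longrightarrow> mul A x y \<in> car A"
    and mul_bilinear: "bilinear_on (scl A) (scl A) (car A) (mul A)"
    and mul_commute: "\<lbrakk>x \<in> car A; y \<in> car A\<rbrakk> \<Longrightarrow> mul A x y = mul A y x"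
    and jacobi: "\<lbrakk>x \<in> car A; y \<in> car A; z \<in> car A\<rbrakk> \<Longrightarrow>
      mul A x (mul A y z) + mul A y (mul A z x) + mul A z (mul A x y) = 0"

definition skew_form :: "('k::field, 'v::ab_group_add, 'z) alg_scheme \<Rightarrow> ('v \<Rightarrow> 'v \<Rightarrow> 'k) \<Rightarrow> bool" where
  "skew_form A w \<longleftrightarrow> bilinear_on (scl A) (*) (car A) w \<and>
     (\<forall>x\<in>car A. \<forall>y\<in>car A. w x y = - w y x)"

definition closed_form :: "('k::field, 'v::ab_group_add, 'z) alg_scheme \<Rightarrow> ('v \<Rightarrow> 'v \<Rightarrow> 'k) \<Rightarrow> bool" where
  "closed_form A w \<longleftrightarrow> (\<forall>x\<in>car A. \<forall>y\<in>car A. \<forall>z\<in>car A.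
     w (mul A x y) z + w (mul A z x) y + w (mul A y z) x = 0)"

definition anti_derivation :: "('k::field, 'v::ab_group_add, 'z) alg_scheme \<Rightarrow> ('v \<Rightarrow> 'v) \<Rightarrow> bool" where
  "anti_derivation A D \<longleftrightarrow> D ` car A \<subseteq> car A \<and> linear_on (scl A) (scl A) (car A) D \<and>
     (\<forall>x\<in>car A. \<forall>y\<in>car A. D (mul A x y) = - mul A (D x) y - mul A x (D y))"

locale symplectic_jj_algebra = jj_algebra "2 * n" H
  for n :: nat and H :: "('k::field, 'v::ab_group_add) symp" +
  assumes sform_skew: "skew_form H (sform H)"
    and sform_nondegenerate: "\<lbrakk>x \<in> car H; \<forall>y\<in>car H. sform H x y = 0\<rbrakk> \<Longrightarrow> x = 0"
    and sform_closed: "closed_form H (sform H)"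

locale symplectic_jj_algebra_der = symplectic_jj_algebra n H
  for n :: nat and H :: "('k::field, 'v::ab_group_add) symp" +
  assumes der_anti_derivation: "anti_derivation H (der H)"
    and der_square: "x \<in> car H \<Longrightarrow> der H (der H x) = 0"
    and der_sform: "\<lbrakk>x \<in> car H; y \<in> car H\<rbrakk> \<Longrightarrow> sform H (der H x) y = sform H x (der H y)"

locale cosymplectic_jj_algebra = jj_algebra "2 * n + 1" J
  for n :: nat and J :: "('k::field, 'v::ab_group_add) cosymp" +
  assumes alpha_linear: "linear_on (scl J) (*) (car J) (alpha J)"
    and omega_skew: "skew_form J (omega J)"
    and volume: "\<exists>vs. length vs = 2 * n + 1 \<and> set vs \<subseteq> car J \<and>
      wedge 1 (2 * n) (form1 (alpha J)) (wedge_power2 (form2 (omega J)) n) vs \<noteq> 0"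
    and alpha_closed: "\<lbrakk>x \<in> car J; y \<in> car J\<rbrakk> \<Longrightarrow> alpha J (mul J x y) = 0"
    and omega_closed: "closed_form J (omega J)"


subsection \<open>Isomorphisms\<close>

definition alg_iso ::
  "('k::field, 'v::ab_group_add, 'y) alg_scheme \<Rightarrow> ('k, 'w::ab_group_add, 'z) alg_scheme \<Rightarrow> ('v \<Rightarrow> 'w) \<Rightarrow> bool"
  where
  "alg_iso A B f \<longleftrightarrow> bij_betw f (car A) (car B) \<and> linear_on (scl A) (scl B) (car A) f \<and>
     (\<forall>x\<in>car A. \<forall>y\<in>car A. f (mul A x y) = mul B (f x) (f y))"

definition symp_iso ::
  "('k::field, 'v::ab_group_add) symp \<Rightarrow> ('k, 'w::ab_group_add) symp \<Rightarrow> bool" where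
  "symp_iso H H' \<longleftrightarrow> (\<exists>f. alg_iso H H' f \<and>
     (\<forall>x\<in>car H. \<forall>y\<in>car H. sform H' (f x) (f y) = sform H x y) \<and>
     (\<forall>x\<in>car H. f (der H x) = der H' (f x)))"

definition cosymp_iso ::
  "('k::field, 'v::ab_group_add) cosymp \<Rightarrow> ('k, 'w::ab_group_add) cosymp \<Rightarrow> bool" where
  "cosymp_iso J J' \<longleftrightarrow> (\<exists>f. alg_iso J J' f \<and>
     (\<forall>x\<in>car J. alpha J' (f x) = alpha J x) \<and>
     (\<forall>x\<in>car J. \<forall>y\<in>car J. omega J' (f x) (f y) = omega J x y))"


subsection \<open>The correspondence\<close>

definition is_reeb :: "('k::field, 'v::ab_group_add) cosymp \<Rightarrow> 'v \<Rightarrow> bool" where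
  "is_reeb J \<xi> \<longleftrightarrow> \<xi> \<in> car J \<and> alpha J \<xi> = 1 \<and> (\<forall>y\<in>car J. omega J \<xi> y = 0)"

definition reeb :: "('k::field, 'v::ab_group_add) cosymp \<Rightarrow> 'v" where
  "reeb J = (THE \<xi>. is_reeb J \<xi>)"

definition reduction :: "('k::field, 'v::ab_group_add) cosymp \<Rightarrow> ('k, 'v) symp" where
  "reduction J = \<lparr>scl = scl J, car = {x \<in> car J. alpha J x = 0}, mul = mul J,
     sform = omega J, der = (\<lambda>x. mul J (reeb J) x)\<rparr>"

text \<open>
  The extension lives on \<open>\<hh> \<oplus> \<bbbK>\<xi>\<close> with \<open>\<xi> = (0, 1)\<close>, \<open>\<xi> \<cdot> x = D x\<close> and \<open>\<xi> \<cdot> \<xi> = 0\<close>.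
\<close>

definition extension :: "('k::field, 'v::ab_group_add) symp \<Rightarrow> ('k, 'v \<times> 'k) cosymp" where
  "extension H = \<lparr>scl = module_prod.scale (scl H) (*), car = car H \<times> UNIV,
     mul = (\<lambda>(x, a) (y, b). (mul H x y + scl H a (der H y) + scl H b (der H x), 0)),
     alpha = snd, omega = (\<lambda>(x, a) (y, b). sform H x y)\<rparr>"

definition cosymp_structures ::
  "nat \<Rightarrow> ('k::field \<Rightarrow> 'v::ab_group_add \<Rightarrow> 'v) \<Rightarrow> 'v set \<Rightarrow> ('k, 'v) cosymp set" where
  "cosymp_structures n s V = {J. cosymplectic_jj_algebra n J \<and> scl J = s \<and> car J = V}"

definition symp_structures ::
  "nat \<Rightarrow> ('k::field \<Rightarrow> 'v::ab_group_add \<Rightarrow> 'v) \<Rightarrow> 'v set \<Rightarrow> ('k, 'v) symp set" where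
  "symp_structures n s V = {H. symplectic_jj_algebra_der n H \<and> scl H = s \<and> car H = V}"

definition cosymp_classes ::
  "nat \<Rightarrow> ('k::field \<Rightarrow> 'v::ab_group_add \<Rightarrow> 'v) \<Rightarrow> 'v set \<Rightarrow> ('k, 'v) cosymp set set" where
  "cosymp_classes n s V = cosymp_structures n s V //
     {(J, J'). J \<in> cosymp_structures n s V \<and> J' \<in> cosymp_structures n s V \<and> cosymp_iso J J'}"

definition symp_classes ::
  "nat \<Rightarrow> ('k::field \<Rightarrow> 'v::ab_group_add \<Rightarrow> 'v) \<Rightarrow> 'v set \<Rightarrow> ('k, 'v) symp set set" where
  "symp_classes n s V = symp_structures n s V //
     {(H, H'). H \<in> symp_structures n s V \<and> H' \<in> symp_structures n s V \<and> symp_iso H H'}"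

text \<open>
  The reduction of a structure on \<open>V\<close> lives on a hyperplane of \<open>V\<close>; it is transported
  to the given space \<open>W\<close> of the same dimension.
\<close>

definition reduction_class ::
  "nat \<Rightarrow> ('k::field \<Rightarrow> 'w::ab_group_add \<Rightarrow> 'w) \<Rightarrow> 'w set \<Rightarrow>
   ('k, 'v::ab_group_add) cosymp set \<Rightarrow> ('k, 'w) symp set" where
  "reduction_class n t W C = {H \<in> symp_structures n t W. \<exists>J\<in>C. symp_iso (reduction J) H}"

end

theory Submission
  imports Defs
begin

text \<open>
  Let \<open>(J, \<alpha>, \<omega>)\<close> be cosymplectic of dimension \<open>2 n + 1\<close>. The nonzero volume form
  \<open>\<alpha> \<and> \<omega>\<^sup>n\<close> has one consequence on which everything else rests: no nonzero vector is
  annihilated by both \<open>\<alpha>\<close> and \<open>\<omega>\<close> (\<open>volume_kernel_trivial\<close>). Since the dimension is odd, the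
  skew-symmetric form \<open>\<omega>\<close> has a radical, so there is exactly one Reeb vector \<open>\<xi>\<close> with
  \<open>\<alpha>(\<xi>) = 1\<close> and \<open>\<omega>(\<xi>, _) = 0\<close>, and \<open>J\<close> is the direct sum of the kernel of \<open>\<alpha>\<close> and the line
  through \<open>\<xi>\<close> (\<open>reeb_vector_exists\<close>, \<open>reeb_unique\<close>). The kernel is a subalgebra on which \<open>\<omega>\<close>
  is nondegenerate. Closedness gives \<open>\<xi> \<cdot> \<xi> = 0\<close>, so all that remains of the product is
  \<open>D x = \<xi> \<cdot> x\<close>. The Jacobi identity and closedness with one or two arguments equal to \<open>\<xi>\<close>
  are the conditions imposed on \<open>D\<close> (\<open>reduction_symplectic\<close>). The computation can be read backwards
  and shows that the extension of \<open>(H, \<omega>, D)\<close> by a line is closed and satisfies the Jacobi identity.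

  The volume form of the extension is the point where the characteristic enters: on
  \<open>\<xi>\<close> followed by a Darboux basis of \<open>H\<close> it equals \<open>n!\<close> (\<open>wedge_power2_standard_pairing\<close>,
  \<open>extension_cosymplectic\<close>). It is therefore nonzero if the characteristic is \<open>0\<close> or larger
  than \<open>n\<close>.

  Reduction and extension are functorial for isomorphisms and inverse to each other up to
  isomorphism, because an isomorphism preserves the Reeb vector. The bijection of isomorphism classes
  on fixed spaces follows after moving structures along linear bijections between spaces of the same
  dimension (\<open>reduction_class_bij\<close>).

  Skew-symmetric forms and their wedge products are treated directly as sums over shuffles. The
  facts required are that wedge products are again skew-symmetric and multilinear
  (\<open>exterior_form_wedge\<close>), that such forms vanish on dependent vectors, and that a maximal list of
  mutually orthogonal hyperbolic pairs spans a complement of the radical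
  (\<open>darboux_basis_exists\<close>).
\<close>

section \<open>Exterior forms and the wedge product\<close>

lemma linear_onD:
  assumes "linear_on s t V f"
  shows "x \<in> V \<Longrightarrow> y \<in> V \<Longrightarrow> f (x + y) = f x + f y"
    and "x \<in> V \<Longrightarrow> f (s c x) = t c (f x)"
  using assms by (auto simp: linear_on_def)

text \<open>
  Skew-symmetry is demanded only under exchange of neighbouring arguments. This is what passes
  through the shuffle sum of a wedge product most easily, and it generates all transpositions.
\<close>
definition exterior_form ::
  "('k::field \<Rightarrow> 'v::ab_group_add \<Rightarrow> 'v) \<Rightarrow> 'v set \<Rightarrow> nat \<Rightarrow> ('v list \<Rightarrow> 'k) \<Rightarrow> bool" where
  "exterior_form s V m f \<longleftrightarrow>
     (\<forall>us ws. length us + length ws + 1 = m \<longrightarrow> set us \<subseteq> V \<longrightarrow> set ws \<subseteq> V \<longrightarrow>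
        linear_on s (*) V (\<lambda>x. f (us @ x # ws))) \<and>
     (\<forall>us x y ws. length us + length ws + 2 = m \<longrightarrow> set us \<subseteq> V \<longrightarrow> set ws \<subseteq> V \<longrightarrow>
        x \<in> V \<longrightarrow> y \<in> V \<longrightarrow> f (us @ x # y # ws) = - f (us @ y # x # ws))"

lemma exterior_form_linear:
  assumes "exterior_form s V m f" "length us + length ws + 1 = m" "set us \<subseteq> V" "set ws \<subseteq> V"
  shows "linear_on s (*) V (\<lambda>x. f (us @ x # ws))"
  using assms unfolding exterior_form_def by blast

lemma exterior_form_swap:
  assumes "exterior_form s V m f" "length us + length ws + 2 = m" "set us \<subseteq> V" "set ws \<subseteq> V"
    and "x \<in> V" "y \<in> V"
  shows "f (us @ x # y # ws) = - f (us @ y # x # ws)"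
  using assms unfolding exterior_form_def by blast

lemma linear_on_sum:
  fixes g :: "'i \<Rightarrow> 'v::ab_group_add \<Rightarrow> 'k::field"
  assumes "\<And>i. i \<in> I \<Longrightarrow> linear_on s (*) V (g i)"
  shows "linear_on s (*) V (\<lambda>x. \<Sum>i\<in>I. g i x)"
  using assms unfolding linear_on_def
  by (auto simp: sum.distrib[symmetric] sum_distrib_left intro!: sum.cong)

lemma linear_on_mult:
  fixes g :: "'v::ab_group_add \<Rightarrow> 'k::field"
  assumes "linear_on s (*) V g"
  shows "linear_on s (*) V (\<lambda>x. c * g x * d)"
  using assms unfolding linear_on_def by (auto simp: algebra_simps)

lemma nths_cong:
  assumes "\<And>i. i < length xs \<Longrightarrow> i \<in> A \<longleftrightarrow> i \<in> B"
  shows "nths xs A = nths xs B"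
proof -
  have "filter (\<lambda>p. snd p \<in> A) (zip xs [0..<length xs]) = filter (\<lambda>p. snd p \<in> B) (zip xs [0..<length xs])"
    by (rule filter_cong[OF refl]) (auto dest!: set_zip_rightD simp: assms)
  then show ?thesis by (simp add: nths_def)
qed

lemma length_nths_subset:
  assumes "A \<subseteq> {..<length xs}"
  shows "length (nths xs A) = card A"
proof -
  have "{i. i < length xs \<and> i \<in> A} = A" using assms by auto
  then show ?thesis by (simp add: length_nths)
qed

text \<open>
  One shuffle of the sum that defines \<^const>\<open>wedge\<close>, with the degrees merged into their sum
  \<open>m\<close>: the exchange of two neighbouring arguments permutes these summands up to sign.
\<close>
definition wedge_term ::
  "nat \<Rightarrow> ('v list \<Rightarrow> 'k::field) \<Rightarrow> ('v list \<Rightarrow> 'k) \<Rightarrow> 'v list \<Rightarrow> nat set \<Rightarrow> 'k" where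
  "wedge_term m a b vs A =
     (-1) ^ card {(i, j). i \<in> A \<and> j \<in> {..<m} - A \<and> j < i} * a (nths vs A) * b (nths vs ({..<m} - A))"

lemma wedge_eq_sum: "wedge p q a b vs = (\<Sum>A | A \<subseteq> {..<p + q} \<and> card A = p. wedge_term (p + q) a b vs A)"
  by (simp add: wedge_def wedge_term_def)

abbreviation adjacent_swap :: "nat \<Rightarrow> nat \<Rightarrow> nat" where
  "adjacent_swap i \<equiv> Transposition.transpose i (Suc i)"

text \<open>
  The transposition preserves the order of every pair of positions except \<open>{i, Suc i}\<close>, so it
  carries the inversions of \<open>A\<close> to inversions of the image, and precisely that pair is new.
\<close>
lemma card_inversions_adjacent_swap:
  assumes A: "A \<subseteq> {..<m}" and "Suc i < m"
  shows "i \<in> A \<Longrightarrow> Suc i \<notin> A \<Longrightarrow>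
    card {(k, j). k \<in> adjacent_swap i ` A \<and> j \<in> {..<m} - adjacent_swap i ` A \<and> j < k}
    = Suc (card {(k, j). k \<in> A \<and> j \<in> {..<m} - A \<and> j < k})"
proof -
  let ?t = "adjacent_swap i"
  let ?I = "\<lambda>A. {(k, j). k \<in> A \<and> j \<in> {..<m} - A \<and> j < k}"
  assume i: "i \<in> A" "Suc i \<notin> A"
  have fin: "finite (?I A)"
    by (rule finite_subset[of _ "{..<m} \<times> {..<m}"]) (use A in auto)
  have mem: "x \<in> ?t ` A \<longleftrightarrow> ?t x \<in> A" for x
    by (metis (no_types, lifting) image_iff transpose_involutory)
  have "?I (?t ` A) = insert (Suc i, i) (map_prod ?t ?t ` ?I A)"
  proof (intro set_eqI iffI)
    fix z assume "z \<in> ?I (?t ` A)"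
    then obtain k j where z: "z = (k, j)" and kj: "?t k \<in> A" "j < m" "?t j \<notin> A" "j < k"
      by (auto simp: mem)
    show "z \<in> insert (Suc i, i) (map_prod ?t ?t ` ?I A)"
    proof (cases "k = Suc i \<and> j = i")
      case False
      have "?t j < m" using kj(2) assms(2) by (auto simp: Transposition.transpose_def)
      moreover have "?t j < ?t k" using kj i False by (auto simp: Transposition.transpose_def split: if_splits)
      ultimately have "(?t k, ?t j) \<in> ?I A" using kj by auto
      then have "map_prod ?t ?t (?t k, ?t j) \<in> map_prod ?t ?t ` ?I A" by (rule imageI)
      then show ?thesis by (simp add: z)
    qed (simp add: z)
  next
    fix z assume "z \<in> insert (Suc i, i) (map_prod ?t ?t ` ?I A)"
    then consider "z = (Suc i, i)" | k j where "z = (?t k, ?t j)" "k \<in> A" "j < m" "j \<notin> A" "j < k"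
      by auto
    then show "z \<in> ?I (?t ` A)"
    proof cases
      case 1
      then show ?thesis using i assms by (auto simp: mem)
    next
      case 2
      have "?t j < m" using 2 assms by (auto simp: Transposition.transpose_def)
      moreover have "?t j < ?t k" using 2 i by (auto simp: Transposition.transpose_def split: if_splits)
      ultimately show ?thesis using 2 by (auto simp: mem)
    qed
  qed
  moreover have "(Suc i, i) \<notin> map_prod ?t ?t ` ?I A"
    using i by (auto simp: Transposition.transpose_def split: if_splits)
  moreover have "inj_on (map_prod ?t ?t) (?I A)"
    by (rule inj_on_subset[OF prod.inj_map]) (simp_all add: bij_is_inj)
  ultimately show ?thesis using fin by (simp add: card_image)
qed

text \<open>
  Exchanging two neighbouring entries is invisible to a selection that moves along with them,
  provided that it does not take both: otherwise their order inside the selection would change.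
\<close>
lemma nths_swap:
  fixes us :: "'v list"
  defines "i \<equiv> length us"
  assumes "\<not> (i \<in> A \<and> Suc i \<in> A)"
  shows "nths (us @ x # y # ws) A = nths (us @ y # x # ws) (adjacent_swap i ` A)"
proof -
  let ?t = "adjacent_swap i"
  have mem: "k \<in> ?t ` A \<longleftrightarrow> ?t k \<in> A" for k
    by (metis (no_types, lifting) image_iff transpose_involutory)
  have "nths us (?t ` A) = nths us A"
    by (rule nths_cong, unfold mem) (auto simp: i_def Transposition.transpose_def)
  moreover have "Suc (Suc (j + i)) \<in> ?t ` A \<longleftrightarrow> Suc (Suc (j + i)) \<in> A" for j
    by (auto simp: mem Transposition.transpose_def)
  ultimately show ?thesis
    using assms(2) by (simp add: nths_append nths_Cons i_def[symmetric] mem)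
qed

text \<open>
  If \<open>A\<close> contains both of the neighbouring positions, the sign comes from the skew-symmetry of
  \<open>a\<close>; if it contains neither, from that of \<open>b\<close>; and if it separates them, from the change of
  the number of inversions.
\<close>
lemma wedge_term_swap:
  fixes a b :: "'v::ab_group_add list \<Rightarrow> 'k::field"
  assumes a: "exterior_form s V p a" and b: "exterior_form s V q b"
    and len: "length us + length ws + 2 = p + q"
    and V: "set us \<subseteq> V" "set ws \<subseteq> V" "x \<in> V" "y \<in> V"
    and A: "A \<subseteq> {..<p + q}" "card A = p"
  shows "wedge_term (p + q) a b (us @ x # y # ws) A =
    - wedge_term (p + q) a b (us @ y # x # ws) (adjacent_swap (length us) ` A)"
proof -
  define i where "i = length us"
  let ?t = "adjacent_swap i"
  let ?v = "us @ x # y # ws" and ?v' = "us @ y # x # ws"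
  let ?B = "{..<p + q} - A"
  have im: "i < p + q" "Suc i < p + q" using len by (auto simp: i_def)
  have lens: "length ?v = p + q" "length ?v' = p + q" using len by auto
  have cB: "card ?B = q" using A by (simp add: card_Diff_subset finite_subset)
  have tm: "?t ` {..<p + q} = {..<p + q}"
    using im by (simp add: transpose_image_eq)
  have tB: "{..<p + q} - ?t ` A = ?t ` ?B"
    using tm by (metis (no_types) bij_is_inj bij_transpose image_set_diff)
  show ?thesis
  proof (cases "i \<in> A \<longleftrightarrow> Suc i \<in> A")
    case same: True
    have tA: "?t ` A = A" using same by (simp add: transpose_image_eq)
    show ?thesis
    proof (cases "i \<in> A")
      case True
      define L R where "L = nths us A" and "R = nths ws {j. Suc (Suc (j + i)) \<in> A}"
      have 1: "nths ?v A = L @ x # y # R" "nths ?v' A = L @ y # x # R"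
        using same True by (auto simp: nths_append nths_Cons i_def L_def R_def)
      have "length (nths ?v A) = p" using A lens by (simp add: length_nths_subset)
      then have "length L + length R + 2 = p" by (simp add: 1)
      then have "a (nths ?v A) = - a (nths ?v' A)"
        unfolding 1 using V by (intro exterior_form_swap[OF a]) (auto simp: L_def R_def dest: in_set_nthsD)
      moreover have "nths ?v ?B = nths ?v' ?B"
        using nths_swap[of us ?B x y ws] same True tB tA by (simp add: i_def[symmetric])
      ultimately show ?thesis
        using tA by (simp add: wedge_term_def i_def[symmetric])
    next
      case False
      define L R where "L = nths us ?B" and "R = nths ws {j. Suc (Suc (j + i)) \<in> ?B}"
      have 1: "nths ?v ?B = L @ x # y # R" "nths ?v' ?B = L @ y # x # R"
        using same False im by (auto simp: nths_append nths_Cons i_def L_def R_def)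
      have "length (nths ?v ?B) = q" using cB lens by (subst length_nths_subset) auto
      then have "length L + length R + 2 = q" by (simp add: 1)
      then have "b (nths ?v ?B) = - b (nths ?v' ?B)"
        unfolding 1 using V by (intro exterior_form_swap[OF b]) (auto simp: L_def R_def dest: in_set_nthsD)
      moreover have "nths ?v A = nths ?v' A"
        using nths_swap[of us A x y ws] same False tA by (simp add: i_def[symmetric])
      ultimately show ?thesis
        using tA by (simp add: wedge_term_def i_def[symmetric])
    qed
  next
    case False
    let ?s = "\<lambda>A. (-1) ^ card {(k, j). k \<in> A \<and> j \<in> {..<p + q} - A \<and> j < k} :: 'k"
    have sgn: "?s (?t ` A) = - ?s A"
    proof (cases "i \<in> A")
      case True
      then show ?thesis using card_inversions_adjacent_swap[OF A(1) im(2)] False by simp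
    next
      case i: False
      have tt: "?t ` (?t ` A) = A" by (simp add: image_image)
      have "i \<in> ?t ` A" "Suc i \<notin> ?t ` A"
        using i False by (auto simp: image_iff Transposition.transpose_def split: if_splits)
      then have "?s (?t ` (?t ` A)) = - ?s (?t ` A)"
        using card_inversions_adjacent_swap[of "?t ` A" "p + q" i] im(2) image_mono[OF A(1), of ?t] tm by simp
      then show ?thesis by (simp add: tt)
    qed
    have "nths ?v A = nths ?v' (?t ` A)" "nths ?v ?B = nths ?v' (?t ` ?B)"
      using nths_swap[of us A x y ws] nths_swap[of us ?B x y ws] False im by (auto simp: i_def)
    then show ?thesis
      unfolding wedge_term_def i_def[symmetric] sgn unfolding tB by simp
  qed
qed

text \<open>
  Linearity holds shuffle by shuffle, because a fixed position goes to exactly one of the two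
  factors. For skew-symmetry the shuffles are reindexed along the transposition of the two positions.
\<close>
lemma exterior_form_wedge:
  fixes a b :: "'v::ab_group_add list \<Rightarrow> 'k::field"
  assumes a: "exterior_form s V p a" and b: "exterior_form s V q b"
  shows "exterior_form s V (p + q) (wedge p q a b)"
  unfolding exterior_form_def
proof (intro conjI allI impI)
  fix us ws :: "'v list"
  assume len: "length us + length ws + 1 = p + q" and V: "set us \<subseteq> V" "set ws \<subseteq> V"
  let ?i = "length us"
  show "linear_on s (*) V (\<lambda>x. wedge p q a b (us @ x # ws))"
    unfolding wedge_eq_sum
  proof (rule linear_on_sum)
    fix A assume "A \<in> {A. A \<subseteq> {..<p + q} \<and> card A = p}"
    then have A: "A \<subseteq> {..<p + q}" "card A = p" by auto
    let ?B = "{..<p + q} - A"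
    have cB: "card ?B = q" using A by (simp add: card_Diff_subset finite_subset)
    let ?L = "\<lambda>A. nths us A" and ?R = "\<lambda>A. nths ws {j. Suc (j + ?i) \<in> A}"
    have split: "nths (us @ x # ws) C = (if ?i \<in> C then ?L C @ x # ?R C else ?L C @ ?R C)" for x C
      by (simp add: nths_append nths_Cons)
    have setLR: "set (?L C) \<subseteq> V" "set (?R C) \<subseteq> V" for C
      using V by (auto dest: in_set_nthsD)
    have len': "length (nths (us @ x # ws) C) = card C" if "C \<subseteq> {..<p + q}" for C x
      using that len by (intro length_nths_subset) simp
    have i: "?i < p + q" using len by simp
    show "linear_on s (*) V (\<lambda>x. wedge_term (p + q) a b (us @ x # ws) A)"
    proof (cases "?i \<in> A")
      case True
      have "length (?L A) + length (?R A) + 1 = p" using len'[OF A(1)] A(2) True by (simp add: split)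
      note lin = exterior_form_linear[OF a this setLR]
      show ?thesis
        unfolding wedge_term_def using True A linear_on_mult[OF lin] by (simp add: split)
    next
      case False
      have "length (?L ?B) + length (?R ?B) + 1 = q" using len'[of ?B] cB False i by (simp add: split)
      note lin = exterior_form_linear[OF b this setLR]
      show ?thesis
        unfolding wedge_term_def
        using False A i linear_on_mult[OF lin, where d = 1] by (simp add: split)
    qed
  qed
next
  fix us ws :: "'v list" and x y
  assume asm: "length us + length ws + 2 = p + q" "set us \<subseteq> V" "set ws \<subseteq> V" "x \<in> V" "y \<in> V"
  let ?t = "adjacent_swap (length us)"
  let ?S = "{A. A \<subseteq> {..<p + q} \<and> card A = p}"
  have tm: "?t ` {..<p + q} = {..<p + q}"
    using asm(1) by (simp add: transpose_image_eq)
  have inv: "?t ` (?t ` A) = A" for A by (simp add: image_image)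
  have "?t ` A \<in> ?S" if "A \<in> ?S" for A
    using that image_mono[of A "{..<p + q}" ?t] tm card_image[of ?t A]
    by (simp add: inj_on_subset[OF bij_is_inj[OF bij_transpose]])
  then have bij: "bij_betw ((`) ?t) ?S ?S"
    by (intro bij_betw_byWitness[where f' = "(`) ?t"]) (auto simp: inv)
  have "wedge p q a b (us @ x # y # ws) = (\<Sum>A\<in>?S. - wedge_term (p + q) a b (us @ y # x # ws) (?t ` A))"
    unfolding wedge_eq_sum by (intro sum.cong refl) (use wedge_term_swap[OF a b asm] in blast)
  also have "\<dots> = (\<Sum>A\<in>?S. - wedge_term (p + q) a b (us @ y # x # ws) A)"
    by (rule sum.reindex_bij_betw[OF bij])
  finally show "wedge p q a b (us @ x # y # ws) = - wedge p q a b (us @ y # x # ws)"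
    by (simp add: wedge_eq_sum sum_negf)
qed

lemma exterior_form_form1:
  assumes "linear_on s (*) V a"
  shows "exterior_form s V 1 (form1 a)"
  using assms by (auto simp: exterior_form_def form1_def)

lemma exterior_form_form2:
  fixes w :: "'v::ab_group_add \<Rightarrow> 'v \<Rightarrow> 'k::field"
  assumes "bilinear_on s (*) V w" "\<And>x y. x \<in> V \<Longrightarrow> y \<in> V \<Longrightarrow> w x y = - w y x"
  shows "exterior_form s V 2 (form2 w)"
  unfolding exterior_form_def
proof (intro conjI allI impI)
  fix us ws :: "'v list" assume *: "length us + length ws + 1 = 2" "set us \<subseteq> V" "set ws \<subseteq> V"
  then consider u where "us = [u]" "ws = []" "u \<in> V" | u where "us = []" "ws = [u]" "u \<in> V"
    by (cases us; cases ws) auto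
  then show "linear_on s (*) V (\<lambda>x. form2 w (us @ x # ws))"
    by cases (use assms(1) in \<open>auto simp: form2_def bilinear_on_def\<close>)
next
  fix us ws :: "'v list" and x y assume "length us + length ws + 2 = 2" "x \<in> V" "y \<in> V"
  then show "form2 w (us @ x # y # ws) = - form2 w (us @ y # x # ws)"
    using assms(2)[of x y] by (simp add: form2_def)
qed

lemma exterior_form_wedge_power2:
  assumes "exterior_form s V 2 w"
  shows "exterior_form s V (2 * n) (wedge_power2 w n)"
proof (induction n)
  case 0
  then show ?case by (simp add: exterior_form_def)
next
  case (Suc n)
  then show ?case using exterior_form_wedge[OF assms Suc] by simp
qed

lemma eq_minus_self_imp_0:
  fixes x :: "'k::field"
  assumes "CHAR('k) \<noteq> 2" "x = - x"
  shows "x = 0"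
proof (rule ccontr)
  assume "x \<noteq> 0"
  have "x + x = 0" using arg_cong[OF assms(2), of "(+) x"] by simp
  then have "2 * x = 0" by (simp only: mult_2)
  then have "of_nat 2 = (0 :: 'k)" using \<open>x \<noteq> 0\<close> by simp
  then have "CHAR('k) dvd 2" by (simp only: of_nat_eq_0_iff_char_dvd)
  then have "CHAR('k) = 1 \<or> CHAR('k) = 2" using prime_nat_iff two_is_prime_nat by blast
  then show False using assms(1) by simp
qed

text \<open>
  Neighbour exchanges bring the two equal entries next to each other, and exchanging them once more
  shows that the value equals its own negative. This is where characteristic \<open>2\<close> has to be excluded.
\<close>
lemma exterior_form_eq_0_repeat:
  fixes f :: "'v::ab_group_add list \<Rightarrow> 'k::field"
  assumes "CHAR('k) \<noteq> 2" and f: "exterior_form s V m f"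
    and "length us + length ms + length ws + 2 = m"
    and "set us \<subseteq> V" "set ms \<subseteq> V" "set ws \<subseteq> V" "x \<in> V"
  shows "f (us @ x # ms @ x # ws) = 0"
  using assms(3-)
proof (induction ms arbitrary: us)
  case Nil
  then have "f (us @ x # x # ws) = - f (us @ x # x # ws)"
    by (intro exterior_form_swap[OF f]) auto
  from eq_minus_self_imp_0[OF assms(1) this] show ?case by simp
next
  case (Cons y ms)
  have "f (us @ x # y # (ms @ x # ws)) = - f (us @ y # x # (ms @ x # ws))"
    using Cons.prems by (intro exterior_form_swap[OF f]) auto
  also have "f (us @ y # x # (ms @ x # ws)) = 0"
    using Cons.IH[of "us @ [y]"] Cons.prems by simp
  finally show ?case by simp
qed

text \<open>
  More vectors than the dimension are dependent, so one of them lies in the span of the others. By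
  linearity in that slot the value is a combination of values with a repeated entry.
\<close>
lemma (in vector_space) exterior_form_eq_0_dependent:
  fixes f :: "'b list \<Rightarrow> 'a"
  assumes char: "CHAR('a) \<noteq> 2" and V: "subspace V" and f: "exterior_form scale V m f"
    and vs: "length vs = m" "set vs \<subseteq> V" and span: "set vs \<subseteq> span B" "finite B" "card B < m"
  shows "f vs = 0"
proof -
  have "\<exists>us x ws. vs = us @ x # ws \<and> x \<in> span (set us \<union> set ws)"
  proof (cases "distinct vs")
    case True
    have "dependent (set vs)"
    proof (rule ccontr)
      assume "\<not> dependent (set vs)"
      then have "card (set vs) \<le> card B" using independent_span_bound span by blast
      then show False using True vs(1) span(3) by (simp add: distinct_card)
    qed
    then obtain x where x: "x \<in> set vs" "x \<in> span (set vs - {x})" by (auto simp: dependent_def)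
    obtain us ws where split: "vs = us @ x # ws" using x(1) by (meson split_list)
    then have "set vs - {x} = set us \<union> set ws" using True by auto
    then show ?thesis using split x(2) by auto
  next
    case False
    then obtain us ms ws x where "vs = us @ [x] @ ms @ [x] @ ws" using not_distinct_decomp by blast
    then have "vs = us @ x # (ms @ x # ws)" "x \<in> span (set us \<union> set (ms @ x # ws))"
      by (auto intro: span_base)
    then show ?thesis by blast
  qed
  then obtain us x ws where split: "vs = us @ x # ws" and x: "x \<in> span (set us \<union> set ws)" by blast
  let ?g = "\<lambda>y. f (us @ y # ws)"
  have lin: "linear_on scale (*) V ?g"
    using vs split by (intro exterior_form_linear[OF f]) auto
  have sub: "set us \<union> set ws \<subseteq> V" using vs split by auto
  have "y \<in> V \<and> ?g y = 0" if "y \<in> span (set us \<union> set ws)" for y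
    using that
  proof (induction rule: span_induct_alt)
    case base
    show ?case using linear_onD(2)[OF lin, of 0 0] subspace_0[OF V] by simp
  next
    case (step c y z)
    have y: "y \<in> V" using step sub by blast
    have "?g y = 0" using step(1)
    proof
      assume "y \<in> set us"
      then obtain as bs where "us = as @ y # bs" by (meson split_list)
      then show ?thesis
        using exterior_form_eq_0_repeat[OF char f, of as bs ws y] vs split by auto
    next
      assume "y \<in> set ws"
      then obtain as bs where "ws = as @ y # bs" by (meson split_list)
      then show ?thesis
        using exterior_form_eq_0_repeat[OF char f, of us as bs y] vs split by auto
    qed
    then show ?case
      using step y linear_onD[OF lin] V by (simp add: subspace_add subspace_scale)
  qed
  then show ?thesis using x split by simp
qed

section \<open>Powers of a 2-form on a Darboux basis\<close>

text \<open>
  The Gram matrix of a Darboux basis \<open>e\<^sub>1, f\<^sub>1, \<dots>, e\<^sub>n, f\<^sub>n\<close>, read above the diagonal. Unlike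
  the inductive description \<open>darboux\<close> below it is visibly stable under deletion of any of the
  pairs \<open>e\<^sub>k, f\<^sub>k\<close>.
\<close>
definition standard_pairing :: "('v \<Rightarrow> 'v \<Rightarrow> 'k::field) \<Rightarrow> 'v list \<Rightarrow> bool" where
  "standard_pairing w vs \<longleftrightarrow>
     (\<forall>i j. i < j \<longrightarrow> j < length vs \<longrightarrow> w (vs ! i) (vs ! j) = (if even i \<and> j = Suc i then 1 else 0))"

lemma nths_insert_last:
  assumes "i < length xs" "\<And>k. k \<in> A \<Longrightarrow> k < i"
  shows "nths xs (insert i A) = nths xs A @ [xs ! i]"
proof -
  have "nths (take i xs @ xs ! i # drop (Suc i) xs) B =
      nths (take i xs) B @ (if i \<in> B then [xs ! i] else []) @ nths (drop (Suc i) xs) {j. Suc (j + i) \<in> B}" for B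
    using assms(1) by (simp add: nths_append nths_Cons)
  moreover have "nths (take i xs) (insert i A) = nths (take i xs) A"
    by (rule nths_cong) auto
  moreover have "{j. Suc (j + i) \<in> insert i A} = {}" "{j. Suc (j + i) \<in> A} = {}" "i \<notin> A"
    using assms(2) by force+
  ultimately show ?thesis
    using assms(1) by (simp add: id_take_nth_drop[symmetric] del: Collect_empty_eq)
qed

lemma nths_pair:
  assumes "i < j" "j < length xs"
  shows "nths xs {i, j} = [xs ! i, xs ! j]"
  using nths_insert_last[of j xs "{i}"] nths_insert_last[of i xs "{}"] assms
  by (simp add: insert_commute)

lemma nths_delete_pair:
  "nths (us @ x # y # ws) ({..<length us + length ws + 2} - {length us, Suc (length us)}) = us @ ws"
  by (auto simp: nths_append nths_Cons nths_all)

lemma standard_pairing_delete: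
  assumes "standard_pairing w (us @ x # y # ws)" "even (length us)"
  shows "standard_pairing w (us @ ws)"
  unfolding standard_pairing_def
proof (intro allI impI)
  fix i j assume ij: "i < j" "j < length (us @ ws)"
  \<comment> \<open>The position before the deletion; it has the parity of \<open>k\<close> since two entries are removed.\<close>
  define r where "r k = (if k < length us then k else k + 2)" for k
  have nth: "(us @ ws) ! k = (us @ x # y # ws) ! r k" for k
    by (auto simp: nth_append r_def)
  have "r i < r j" "r j < length (us @ x # y # ws)"
    using ij by (auto simp: r_def)
  then have "w ((us @ ws) ! i) ((us @ ws) ! j) = (if even (r i) \<and> r j = Suc (r i) then 1 else 0)"
    using assms(1) unfolding nth standard_pairing_def by blast
  also have "even (r i) \<and> r j = Suc (r i) \<longleftrightarrow> even i \<and> j = Suc i"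
    using assms(2) by (auto simp: r_def) presburger
  finally show "w ((us @ ws) ! i) ((us @ ws) ! j) = (if even i \<and> j = Suc i then 1 else 0)" .
qed

text \<open>
  In \<open>w \<and> w\<^sup>n\<close> only the shuffles that give a pair \<open>e\<^sub>k, f\<^sub>k\<close> to the first factor survive. There
  are \<open>n + 1\<close> of them. Each has sign \<open>+1\<close>, because two adjacent arguments move past an even number of
  others, and leaves a standard list of \<open>n\<close> pairs, worth \<open>n!\<close>. The factorial is cast from the
  naturals because it can vanish in positive characteristic.
\<close>
lemma wedge_power2_standard_pairing:
  fixes w :: "'v \<Rightarrow> 'v \<Rightarrow> 'k::field"
  assumes "length vs = 2 * n" "standard_pairing w vs"
  shows "wedge_power2 (form2 w) n vs = of_nat (fact n)"
  using assms
proof (induction n arbitrary: vs)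
  case (Suc n)
  define m where "m = 2 + 2 * n"
  let ?W = "wedge_power2 (form2 w) n"
  let ?S = "{A. A \<subseteq> {..<m} \<and> card A = 2}"
  let ?P = "\<lambda>k. {2 * k, Suc (2 * k)}"
  have len: "length vs = m" using Suc.prems by (simp add: m_def)
  have zero: "wedge_term m (form2 w) ?W vs A = 0" if "A \<in> ?S - ?P ` {..n}" for A
  proof -
    have "card A = 2" using that by simp
    then obtain a b where "A = {a, b}" "a \<noteq> b" by (meson card_2_iff)
    then obtain i j where A: "A = {i, j}" "i < j"
      by (metis insert_commute linorder_neqE_nat)
    have j: "j < m" using that A by auto
    have "\<not> (even i \<and> j = Suc i)"
    proof
      assume e: "even i \<and> j = Suc i"
      then obtain k where "i = 2 * k" by auto
      then show False using that A e j by (auto simp: m_def)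
    qed
    then have "w (vs ! i) (vs ! j) = 0"
      using Suc.prems(2) A j len unfolding standard_pairing_def by auto
    then show ?thesis
      unfolding wedge_term_def using A j len by (simp add: nths_pair form2_def)
  qed
  have one: "wedge_term m (form2 w) ?W vs (?P k) = of_nat (fact n)" if k: "k \<le> n" for k
  proof -
    define us ws where "us = take (2 * k) vs" and "ws = drop (Suc (Suc (2 * k))) vs"
    have k': "Suc (2 * k) < m" using k by (simp add: m_def)
    have split: "vs = us @ vs ! (2 * k) # vs ! Suc (2 * k) # ws"
      unfolding us_def ws_def using k' len
      by (metis Cons_nth_drop_Suc Suc_lessD append_take_drop_id)
    have lens: "length us = 2 * k" "length us + length ws + 2 = m"
      using k' len by (auto simp: us_def ws_def)
    have "w (vs ! (2 * k)) (vs ! Suc (2 * k)) = 1"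
      using Suc.prems(2) k' len unfolding standard_pairing_def by auto
    then have "form2 w (nths vs (?P k)) = 1"
      using k' len by (simp add: nths_pair form2_def)
    moreover have "nths vs ({..<m} - ?P k) = us @ ws"
      using nths_delete_pair[of us "vs ! (2 * k)" "vs ! Suc (2 * k)" ws] split lens by simp
    moreover have "?W (us @ ws) = of_nat (fact n)"
      using Suc.IH[of "us @ ws"] standard_pairing_delete[of w us _ _ ws] Suc.prems(2) split lens
      by (simp add: m_def) (metis dvd_triv_left)
    \<comment> \<open>Both chosen positions are inverted with exactly the \<open>2 * k\<close> positions before the pair.\<close>
    moreover have "{(i, j). i \<in> ?P k \<and> j \<in> {..<m} - ?P k \<and> j < i} = ?P k \<times> {..<2 * k}"
      using k' by auto
    moreover have "card (?P k \<times> {..<2 * k}) = 2 * (2 * k)"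
      by (subst card_cartesian_product) simp
    ultimately show ?thesis
      unfolding wedge_term_def by simp
  qed
  have inj: "inj_on ?P {..n}" by (rule inj_onI) (auto simp: doubleton_eq_iff)
  have "wedge_power2 (form2 w) (Suc n) vs = (\<Sum>A\<in>?S. wedge_term m (form2 w) ?W vs A)"
    by (simp add: wedge_eq_sum m_def)
  also have "\<dots> = (\<Sum>A\<in>?P ` {..n}. wedge_term m (form2 w) ?W vs A)"
    by (rule sum.mono_neutral_right) (use zero in \<open>auto simp: m_def\<close>)
  also have "\<dots> = (\<Sum>k\<le>n. of_nat (fact n))"
    by (subst sum.reindex[OF inj]) (simp add: one)
  also have "\<dots> = of_nat (fact (Suc n))" by (simp add: algebra_simps)
  finally show ?case .
qed simp

lemma wedge_1_Cons:
  assumes "length vs = q" "\<And>v. v \<in> set vs \<Longrightarrow> a v = 0"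
  shows "wedge 1 q (form1 a) b (x # vs) = a x * b vs"
proof -
  let ?S = "{A. A \<subseteq> {..<1 + q} \<and> card A = 1}"
  have sing: "nths (x # vs) {i} = [(x # vs) ! i]" if "i < 1 + q" for i
    using nths_insert_last[of i "x # vs" "{}"] that assms(1) by simp
  have "wedge_term (1 + q) (form1 a) b (x # vs) A = 0" if "A \<in> ?S - {{0}}" for A
  proof -
    have "card A = 1" using that by simp
    then obtain i where i: "A = {i}" by (meson card_1_singletonE)
    then have "i \<noteq> 0" using that by auto
    then obtain j where j: "i = Suc j" by (cases i) auto
    have "i < 1 + q" using that i by auto
    then show ?thesis
      using i j assms by (simp add: wedge_term_def sing form1_def)
  qed
  then have "wedge 1 q (form1 a) b (x # vs) = (\<Sum>A\<in>{{0}}. wedge_term (1 + q) (form1 a) b (x # vs) A)"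
    unfolding wedge_eq_sum by (intro sum.mono_neutral_right) auto
  also have "\<dots> = wedge_term (1 + q) (form1 a) b (x # vs) {0}" by simp
  also have "\<dots> = a x * b vs"
  proof -
    have "nths (x # vs) ({..<1 + q} - {0}) = vs"
      using assms(1) by (auto simp: nths_Cons nths_all)
    moreover have "{(i, j). i \<in> {0::nat} \<and> j \<in> {..<1 + q} - {0} \<and> j < i} = {}" by auto
    ultimately show ?thesis
      using sing[of 0] by (simp only: wedge_term_def) (simp add: form1_def)
  qed
  finally show ?thesis .
qed

section \<open>Skew-symmetric bilinear forms\<close>

text \<open>
  Lists \<open>e\<^sub>1, f\<^sub>1, e\<^sub>2, f\<^sub>2, \<dots>\<close> of mutually orthogonal hyperbolic pairs. Adding pairs in front makes
  linear algebra with them a rule induction.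
\<close>
inductive darboux :: "'v set \<Rightarrow> ('v \<Rightarrow> 'v \<Rightarrow> 'k::field) \<Rightarrow> 'v list \<Rightarrow> bool" for V w where
  Nil: "darboux V w []"
| Cons: "darboux V w vs \<Longrightarrow> e \<in> V \<Longrightarrow> f \<in> V \<Longrightarrow> w e f = 1 \<Longrightarrow>
    (\<And>v. v \<in> set vs \<Longrightarrow> w e v = 0 \<and> w f v = 0) \<Longrightarrow> darboux V w (e # f # vs)"

lemma darboux_subset: "darboux V w vs \<Longrightarrow> set vs \<subseteq> V"
  by (induction rule: darboux.induct) auto

lemma darboux_even: "darboux V w vs \<Longrightarrow> even (length vs)"
  by (induction rule: darboux.induct) auto

lemma darboux_standard_pairing: "darboux V w vs \<Longrightarrow> standard_pairing w vs"
proof (induction rule: darboux.induct)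
  case (Cons vs e f)
  show ?case
    unfolding standard_pairing_def
  proof (intro allI impI)
    fix i j assume ij: "i < j" "j < length (e # f # vs)"
    consider "i = 0" "j = 1" | j' where "i \<le> 1" "j = Suc (Suc j')"
      | i' j' where "i = Suc (Suc i')" "j = Suc (Suc j')"
      using ij(1) by (cases i rule: nat.exhaust; cases "i - 1"; cases j; cases "j - 1") auto
    then show "w ((e # f # vs) ! i) ((e # f # vs) ! j) = (if even i \<and> j = Suc i then 1 else 0)"
    proof cases
      case 2
      then show ?thesis using Cons ij by (cases i) auto
    next
      case 3
      then show ?thesis using Cons.IH ij unfolding standard_pairing_def by auto
    qed (use Cons in auto)
  qed
qed (simp add: standard_pairing_def)

locale skew_space = vector_space scale
  for scale :: "'k::field \<Rightarrow> 'v::ab_group_add \<Rightarrow> 'v" +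
  fixes V :: "'v set" and w :: "'v \<Rightarrow> 'v \<Rightarrow> 'k"
  assumes char_neq_2: "CHAR('k) \<noteq> 2"
    and V: "subspace V"
    and bilinear: "bilinear_on scale (*) V w"
    and skew: "x \<in> V \<Longrightarrow> y \<in> V \<Longrightarrow> w x y = - w y x"
begin

lemma w_add_left: "x \<in> V \<Longrightarrow> y \<in> V \<Longrightarrow> z \<in> V \<Longrightarrow> w (x + y) z = w x z + w y z"
  using bilinear by (auto simp: bilinear_on_def linear_on_def)

lemma w_add_right: "x \<in> V \<Longrightarrow> y \<in> V \<Longrightarrow> z \<in> V \<Longrightarrow> w z (x + y) = w z x + w z y"
  using bilinear by (auto simp: bilinear_on_def linear_on_def)

lemma w_scale_left: "x \<in> V \<Longrightarrow> z \<in> V \<Longrightarrow> w (scale c x) z = c * w x z"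
  using bilinear by (auto simp: bilinear_on_def linear_on_def)

lemma w_scale_right: "x \<in> V \<Longrightarrow> z \<in> V \<Longrightarrow> w z (scale c x) = c * w z x"
  using bilinear by (auto simp: bilinear_on_def linear_on_def)

lemma w_diff_left: "x \<in> V \<Longrightarrow> y \<in> V \<Longrightarrow> z \<in> V \<Longrightarrow> w (x - y) z = w x z - w y z"
  using w_add_left[of "x - y" y z] subspace_diff[OF V] by simp

lemma w_self: "x \<in> V \<Longrightarrow> w x x = 0"
  using eq_minus_self_imp_0[OF char_neq_2 skew] .

lemma orthogonal_span:
  assumes "x \<in> V" "S \<subseteq> V" "\<And>v. v \<in> S \<Longrightarrow> w x v = 0" "y \<in> span S"
  shows "w x y = 0"
proof -
  have "y \<in> V \<and> w x y = 0"
    using assms(4)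
  proof (induction rule: span_induct_alt)
    case base
    show ?case using w_scale_right[of 0 x 0] subspace_0[OF V] assms(1) by simp
  next
    case (step c v z)
    then show ?case
      using assms V by (auto simp: w_add_right w_scale_right subspace_add subspace_scale subset_iff)
  qed
  then show ?thesis by simp
qed

text \<open>
  Pairing with \<open>e\<close> separates \<open>f\<close> from the span of the later vectors, and pairing with \<open>f\<close>
  separates \<open>e\<close> from the span of \<open>f\<close> and the later vectors.
\<close>
lemma darboux_independent:
  assumes "darboux V w vs"
  shows "independent (set vs) \<and> distinct vs"
  using assms
proof (induction rule: darboux.induct)
  case (Cons vs e f)
  have sub: "set vs \<subseteq> V" using Cons darboux_subset by blast
  have f: "f \<notin> span (set vs)"
  proof
    assume "f \<in> span (set vs)"
    then have "w e f = 0" using Cons sub by - (rule orthogonal_span[of e "set vs"], auto)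
    then show False using Cons by simp
  qed
  have "w f e \<noteq> 0" using Cons skew[of f e] by simp
  have e: "e \<notin> span (insert f (set vs))"
  proof
    assume "e \<in> span (insert f (set vs))"
    then have "w f e = 0"
      using Cons sub w_self by - (rule orthogonal_span[of f "insert f (set vs)"], auto)
    then show False using \<open>w f e \<noteq> 0\<close> by simp
  qed
  show ?case
    using Cons.IH e f by (auto simp: independent_insertI intro: span_base)
qed (simp add: independent_empty)

text \<open>
  The span of a Darboux list is a nondegenerate subspace, so every vector of \<open>V\<close> has an orthogonal
  projection onto it. A new hyperbolic pair is orthogonal to the old list and contributes its own
  component independently.
\<close>
lemma darboux_projection:
  assumes "darboux V w vs" "x \<in> V"
  shows "\<exists>p\<in>span (set vs). \<forall>v\<in>set vs. w (x - p) v = 0"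
  using assms(1)
proof (induction rule: darboux.induct)
  case Nil
  then show ?case by (auto intro: span_zero)
next
  case (Cons vs e f)
  then obtain p where p: "p \<in> span (set vs)" "\<And>v. v \<in> set vs \<Longrightarrow> w (x - p) v = 0" by blast
  have sub: "set vs \<subseteq> V" using Cons darboux_subset by blast
  then have pV: "p \<in> V" using p(1) span_minimal[OF _ V] by blast
  define y where "y = x - p"
  have yV: "y \<in> V" using pV assms(2) V by (simp add: y_def subspace_diff)
  \<comment> \<open>The component of \<open>y\<close> in the hyperbolic plane of \<open>e\<close> and \<open>f\<close>; the sign of the second
    coefficient reflects \<open>w f e = - 1\<close>.\<close>
  define q where "q = scale (w y f) e - scale (w y e) f"
  have qV: "q \<in> V" using Cons V by (simp add: q_def subspace_diff subspace_scale)
  have q: "w q v = w y f * w e v - w y e * w f v" if "v \<in> V" for v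
    using that Cons V by (simp add: q_def w_diff_left w_scale_left subspace_scale)
  have "w (y - q) v = 0" if "v \<in> set (e # f # vs)" for v
  proof -
    have v: "v \<in> V" using that sub Cons by auto
    have "w y v = w q v"
      using that p(2) Cons v skew[of f e] w_self by (auto simp: q y_def[symmetric])
    then show ?thesis using v yV qV by (simp add: w_diff_left)
  qed
  moreover have "p + q \<in> span (set (e # f # vs))"
    unfolding q_def using p(1) span_mono[of "set vs" "set (e # f # vs)"]
    by (intro span_add span_diff span_scale) (auto intro: span_base)
  ultimately show ?case
    by (intro bexI[of _ "p + q"]) (auto simp: y_def algebra_simps)
qed

text \<open>
  A Darboux list of maximal length spans a complement of the radical: if the component of some \<open>x\<close>
  orthogonal to the list did not pair to zero with all of \<open>V\<close>, then it would start a further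
  hyperbolic pair.
\<close>
lemma darboux_basis_exists:
  assumes B: "finite B" "V \<subseteq> span B"
  obtains vs where "darboux V w vs"
    and "\<And>x. x \<in> V \<Longrightarrow> \<exists>p\<in>span (set vs). \<forall>y\<in>V. w (x - p) y = 0"
proof -
  have bound: "length vs \<le> card B" if "darboux V w vs" for vs
  proof -
    have "set vs \<subseteq> span B" using darboux_subset[OF that] B(2) by blast
    then show ?thesis
      using darboux_independent[OF that] independent_span_bound[OF B(1)] by (metis distinct_card)
  qed
  define vs where "vs = (ARG_MAX length vs. darboux V w vs)"
  have vs: "darboux V w vs" "\<And>us. darboux V w us \<Longrightarrow> length us \<le> length vs"
    unfolding vs_def using arg_max_nat_lemma[of "darboux V w" "[]" length "Suc (card B)"] bound
    by (auto intro: darboux.Nil simp: less_Suc_eq_le)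
  have sub: "set vs \<subseteq> V" using darboux_subset vs by blast
  have span_sub: "span (set vs) \<subseteq> V" using sub span_minimal[OF _ V] by blast
  have "\<exists>p\<in>span (set vs). \<forall>y\<in>V. w (x - p) y = 0" if x: "x \<in> V" for x
  proof -
    obtain p where p: "p \<in> span (set vs)" "\<And>v. v \<in> set vs \<Longrightarrow> w (x - p) v = 0"
      using darboux_projection[OF vs(1) x] by blast
    have e: "x - p \<in> V" using p(1) span_sub x V by (auto intro: subspace_diff)
    have "w (x - p) y = 0" if y: "y \<in> V" for y
    proof (rule ccontr)
      assume neq: "w (x - p) y \<noteq> 0"
      obtain q where q: "q \<in> span (set vs)" "\<And>v. v \<in> set vs \<Longrightarrow> w (y - q) v = 0"
        using darboux_projection[OF vs(1) y] by blast
      have qV: "q \<in> V" using q(1) span_sub by blast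
      have "w (x - p) q = 0" using orthogonal_span[OF e sub p(2) q(1)] .
      define f where "f = scale (inverse (w (x - p) y)) (y - q)"
      have yq: "y - q \<in> V" using y qV V by (rule subspace_diff[rotated])
      have f: "f \<in> V" using yq V by (simp add: f_def subspace_scale)
      have "w (x - p) (y - q) = w (x - p) y"
        using \<open>w (x - p) q = 0\<close> w_add_right[OF yq qV e] by simp
      then have "w (x - p) f = 1" using neq yq e by (simp add: f_def w_scale_right)
      then have "darboux V w ((x - p) # f # vs)"
        using vs(1) e f p(2) q(2) sub yq by - (rule darboux.Cons, auto simp: f_def w_scale_left subset_iff)
      then show False using vs(2) by fastforce
    qed
    then show ?thesis using p(1) by blast
  qed
  then show thesis using that vs(1) by blast
qed

end

section \<open>Dimension\<close>

lemma has_dim_iff_basis: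
  "has_dim s V d \<longleftrightarrow> vector_space s \<and>
     (\<exists>B. finite B \<and> \<not> module.dependent s B \<and> module.span s B = V \<and> card B = d)"
proof
  assume dim: "has_dim s V d"
  then interpret vector_space s by (simp add: has_dim_def)
  obtain C where C: "finite C" "span C = V" "subspace V" "dim V = d"
    using dim by (auto simp: has_dim_def)
  obtain B where B: "B \<subseteq> V" "independent B" "V \<subseteq> span B" "card B = dim V"
    by (rule basis_exists)
  have "finite B" using independent_span_bound[OF C(1) B(2)] B(1) C(2) by simp
  moreover have "span B = V" using B C(3) by (simp add: span_subspace)
  ultimately show "vector_space s \<and>
      (\<exists>B. finite B \<and> independent B \<and> span B = V \<and> card B = d)"
    using B C vector_space_axioms by auto
next
  assume asm: "vector_space s \<and>
    (\<exists>B. finite B \<and> \<not> module.dependent s B \<and> module.span s B = V \<and> card B = d)"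
  then interpret vector_space s by simp
  obtain B where B: "finite B" "independent B" "span B = V" "card B = d" using asm by auto
  have "dim V = d" using dim_span_eq_card_independent[OF B(2)] B by simp
  moreover have "subspace V" using B(3) subspace_span by blast
  ultimately show "has_dim s V d"
    using B vector_space_axioms unfolding has_dim_def by blast
qed

lemma has_dim_add_line:
  assumes U: "has_dim s U d" and V: "module.subspace s V" "U \<subseteq> V" "x \<in> V" "x \<notin> U"
    and line: "\<And>v. v \<in> V \<Longrightarrow> \<exists>c. v - s c x \<in> U"
  shows "has_dim s V (Suc d)"
proof -
  interpret vector_space s using U by (simp add: has_dim_def)
  obtain B where B: "finite B" "independent B" "span B = U" "card B = d"
    using U by (auto simp: has_dim_iff_basis)
  have "B \<subseteq> U" using B(3) span_superset by blast
  then have "span (insert x B) \<subseteq> V" using V by (intro span_minimal) auto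
  moreover have "V \<subseteq> span (insert x B)"
    using line B(3) by (auto simp: span_breakdown_eq)
  ultimately have "span (insert x B) = V" by blast
  moreover have "independent (insert x B)" using B V(4) by (simp add: independent_insertI)
  moreover have "x \<notin> B" using \<open>B \<subseteq> U\<close> V(4) by blast
  ultimately show ?thesis
    unfolding has_dim_iff_basis using B vector_space_axioms
    by (intro conjI exI[of _ "insert x B"]) auto
qed

lemma has_dim_hyperplane:
  assumes V: "has_dim s V (Suc d)" and U: "module.subspace s U" "U \<subseteq> V" "x \<in> V" "x \<notin> U"
    and line: "\<And>v. v \<in> V \<Longrightarrow> \<exists>c. v - s c x \<in> U"
  shows "has_dim s U d"
proof -
  interpret vector_space s using V by (simp add: has_dim_def)
  obtain C where C: "finite C" "span C = V" "subspace V" using V by (auto simp: has_dim_def)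
  obtain B where B: "B \<subseteq> U" "independent B" "U \<subseteq> span B" "card B = dim U"
    by (rule basis_exists)
  have "finite B" using independent_span_bound[OF C(1) B(2)] B(1) C(2) U(2) by blast
  moreover have "span B = U" using B U(1) by (simp add: span_subspace)
  ultimately have *: "has_dim s U (card B)"
    using B(2) vector_space_axioms unfolding has_dim_iff_basis by blast
  then have "has_dim s V (Suc (card B))" using C U line by (intro has_dim_add_line)
  then have "card B = d" using V by (simp add: has_dim_def)
  then show ?thesis using * by simp
qed

text \<open>
  Reduces maps that are linear only on a subspace to maps that are linear everywhere,
  for which images of spans and of independent sets are understood.
\<close>
lemma linear_on_extend:
  assumes "vector_space s" "vector_space t" "module.subspace s V" "linear_on s t V f"
  shows "\<exists>g. Vector_Spaces.linear s t g \<and> (\<forall>x\<in>V. g x = f x)"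
proof -
  interpret vector_space_pair s t using assms by (simp add: vector_space_pair_def)
  obtain B where B: "B \<subseteq> V" "vs1.independent B" "V \<subseteq> vs1.span B" "card B = vs1.dim V"
    by (rule vs1.basis_exists)
  obtain g where g: "Vector_Spaces.linear s t g" "\<And>x. x \<in> B \<Longrightarrow> g x = f x"
    using linear_independent_extend[OF B(2)] by blast
  interpret g: Vector_Spaces.linear s t g by fact
  have "x \<in> V \<and> g x = f x" if "x \<in> vs1.span B" for x
    using that
  proof (induction rule: vs1.span_induct_alt)
    case base
    have "f (s 0 0) = t 0 (f 0)" using linear_onD(2)[OF assms(4)] vs1.subspace_0[OF assms(3)] by blast
    then show ?case using vs1.subspace_0[OF assms(3)] by (simp add: g.zero)
  next
    case (step c x y)
    then have "x \<in> V" "s c x \<in> V" using B(1) assms(3) by (auto simp: vs1.subspace_scale)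
    then show ?case
      using step g(2) linear_onD[OF assms(4)] assms(3)
      by (simp add: g.add g.scale vs1.subspace_add)
  qed
  then show ?thesis using g(1) B(3) by blast
qed

lemma has_dim_image:
  assumes "has_dim s V d" "vector_space t" "linear_on s t V f" "inj_on f V"
  shows "has_dim t (f ` V) d"
proof -
  interpret vector_space_pair s t
    using assms by (simp add: vector_space_pair_def has_dim_def)
  obtain g where g: "Vector_Spaces.linear s t g" "\<And>x. x \<in> V \<Longrightarrow> g x = f x"
    using linear_on_extend[OF _ assms(2) _ assms(3)] assms(1) by (auto simp: has_dim_def)
  obtain B where B: "finite B" "vs1.independent B" "vs1.span B = V" "card B = d"
    using assms(1) by (auto simp: has_dim_iff_basis)
  have gV: "g ` V = f ` V" using g(2) by (rule image_cong[OF refl])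
  have inj: "inj_on g (vs1.span B)" using assms(4) g(2) B(3) by (simp add: inj_on_def)
  have "vs2.independent (g ` B)"
    using linear_independent_injective_image[OF g(1) B(2)] inj by simp
  moreover have "vs2.span (g ` B) = f ` V"
    using linear_span_image[OF g(1)] B(3) gV by simp
  moreover have "card (g ` B) = d"
    using card_image[OF inj_on_subset[OF inj vs1.span_superset]] B(4) by simp
  ultimately show ?thesis
    using B(1) assms(2) unfolding has_dim_iff_basis by blast
qed

lemma has_dim_isomorphic:
  assumes "has_dim s V d" "has_dim t W d"
  obtains f where "bij_betw f V W" "linear_on s t V f"
proof -
  interpret vector_space_pair s t
    using assms by (simp add: vector_space_pair_def has_dim_def)
  obtain B where B: "finite B" "vs1.independent B" "vs1.span B = V" "card B = d"
    using assms(1) by (auto simp: has_dim_iff_basis)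
  obtain C where C: "finite C" "vs2.independent C" "vs2.span C = W" "card C = d"
    using assms(2) by (auto simp: has_dim_iff_basis)
  have "\<exists>f. Vector_Spaces.linear s t f \<and> f ` B = C \<and> f ` V = W \<and> inj_on f V"
    using assms B C vs1.span_superset vs2.span_superset
    by (intro finite_basis_to_basis_subspace_isomorphism) (auto simp: has_dim_def)
  then obtain f where f: "Vector_Spaces.linear s t f" "f ` V = W" "inj_on f V" by blast
  interpret f: Vector_Spaces.linear s t f by fact
  show thesis
    using f(2,3) by (intro that[of f]) (auto simp: bij_betw_def linear_on_def f.add f.scale)
qed

section \<open>The volume form of a cosymplectic pair\<close>

lemma wedge_map:
  assumes "\<And>us. length us = p \<Longrightarrow> set us \<subseteq> S \<Longrightarrow> a' (map f us) = a us"
    and "\<And>us. length us = q \<Longrightarrow> set us \<subseteq> S \<Longrightarrow> b' (map f us) = b us"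
    and "length vs = p + q" "set vs \<subseteq> S"
  shows "wedge p q a' b' (map f vs) = wedge p q a b vs"
  unfolding wedge_eq_sum
proof (rule sum.cong[OF refl])
  fix A assume "A \<in> {A. A \<subseteq> {..<p + q} \<and> card A = p}"
  then have A: "A \<subseteq> {..<p + q}" "card A = p" by auto
  then have "card ({..<p + q} - A) = q" by (simp add: card_Diff_subset finite_subset)
  then have "a' (map f (nths vs A)) = a (nths vs A)"
    "b' (map f (nths vs ({..<p + q} - A))) = b (nths vs ({..<p + q} - A))"
    using A assms(3,4)
    by (auto intro!: assms(1,2) simp: length_nths_subset dest: in_set_nthsD)
  then show "wedge_term (p + q) a' b' (map f vs) A = wedge_term (p + q) a b vs A"
    by (simp add: wedge_term_def nths_map)
qed

lemma wedge_power2_map: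
  assumes "\<And>x y. x \<in> S \<Longrightarrow> y \<in> S \<Longrightarrow> w' (f x) (f y) = w x y"
    and "length vs = 2 * n" "set vs \<subseteq> S"
  shows "wedge_power2 (form2 w') n (map f vs) = wedge_power2 (form2 w) n vs"
  using assms(2,3)
proof (induction n arbitrary: vs)
  case (Suc n)
  have "form2 w' (map f us) = form2 w us" if "length us = 2" "set us \<subseteq> S" for us
    using that assms(1) by (simp add: form2_def subset_iff)
  then have "wedge 2 (2 * n) (form2 w') (wedge_power2 (form2 w') n) (map f vs)
      = wedge 2 (2 * n) (form2 w) (wedge_power2 (form2 w) n) vs"
    using Suc.prems by (intro wedge_map[where S = S] Suc.IH) auto
  then show ?case by simp
qed simp

lemma volume_map:
  assumes "\<And>x. x \<in> S \<Longrightarrow> a' (f x) = a x"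
    and "\<And>x y. x \<in> S \<Longrightarrow> y \<in> S \<Longrightarrow> w' (f x) (f y) = w x y"
    and "length vs = 2 * n + 1" "set vs \<subseteq> S"
  shows "wedge 1 (2 * n) (form1 a') (wedge_power2 (form2 w') n) (map f vs)
       = wedge 1 (2 * n) (form1 a) (wedge_power2 (form2 w) n) vs"
  using assms
  by (intro wedge_map[where S = S]) (auto simp: form1_def subset_iff intro!: wedge_power2_map[where S = S])

context skew_space
begin

text \<open>
  Suppose that \<open>r \<noteq> 0\<close> is annihilated by both \<open>a\<close> and \<open>w\<close>. Then the volume form does not change when
  its arguments are projected along \<open>r\<close> to a complement of dimension \<open>2 n\<close>, where an exterior form of
  degree \<open>2 n + 1\<close> vanishes.
\<close>
lemma volume_kernel_trivial:
  assumes dim: "has_dim scale V (2 * n + 1)" and a: "linear_on scale (*) V a"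
    and vol: "length vs = 2 * n + 1" "set vs \<subseteq> V"
      "wedge 1 (2 * n) (form1 a) (wedge_power2 (form2 w) n) vs \<noteq> 0"
    and r: "r \<in> V" "a r = 0" "\<And>y. y \<in> V \<Longrightarrow> w r y = 0"
  shows "r = 0"
proof (rule ccontr)
  assume "r \<noteq> 0"
  let ?vol = "wedge 1 (2 * n) (form1 a) (wedge_power2 (form2 w) n)"
  obtain B where B: "{r} \<subseteq> B" "B \<subseteq> V" "independent B" "V \<subseteq> span B"
    using maximal_independent_subset_extend[of "{r}" V] r(1) \<open>r \<noteq> 0\<close> by auto
  have cB: "card B = 2 * n + 1" using basis_card_eq_dim[OF B(2,4,3)] dim by (simp add: has_dim_def)
  then have finB: "finite B" by (rule_tac card_ge_0_finite) simp
  have "\<exists>k. v - scale k r \<in> span (B - {r})" if "v \<in> V" for v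
    using B span_breakdown[of r B v] that by blast
  then obtain k where k: "\<And>v. v \<in> V \<Longrightarrow> v - scale (k v) r \<in> span (B - {r})" by metis
  \<comment> \<open>A projection along \<open>r\<close> onto the span of the other basis vectors. The forms \<open>a\<close> and
    \<open>w\<close> do not see the difference between \<open>v\<close> and \<open>p v\<close>.\<close>
  define p where "p v = v - scale (k v) r" for v
  have pV: "p v \<in> V" if "v \<in> V" for v
    using that r V by (simp add: p_def subspace_diff subspace_scale)
  have dec: "v = p v + scale (k v) r" for v by (simp add: p_def)
  have kr: "scale c r \<in> V" for c using r V by (simp add: subspace_scale)
  have ap: "a (p v) = a v" if "v \<in> V" for v
    using linear_onD(1)[OF a pV[OF that] kr[of "k v"]] linear_onD(2)[OF a r(1), of "k v"] r(2)
    by (simp add: dec[symmetric])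
  have wp: "w (p u) (p v) = w u v" if "u \<in> V" "v \<in> V" for u v
  proof -
    have "w u v = w (p u) v"
      using w_add_left[OF pV[OF that(1)] kr[of "k u"] that(2)] w_scale_left[OF r(1) that(2), of "k u"]
        r(3)[OF that(2)] by (simp add: dec[symmetric])
    also have "\<dots> = w (p u) (p v)"
      using w_add_right[OF pV[OF that(2)] kr[of "k v"] pV[OF that(1)]]
        w_scale_right[OF r(1) pV[OF that(1)], of "k v"] skew[OF r(1) pV[OF that(1)]]
        r(3)[OF pV[OF that(1)]] by (simp add: dec[symmetric])
    finally show ?thesis ..
  qed
  have ext: "exterior_form scale V (1 + 2 * n) ?vol"
    using a bilinear skew
    by (intro exterior_form_wedge exterior_form_wedge_power2 exterior_form_form1 exterior_form_form2)
  have "?vol (map p vs) = 0"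
  proof (rule exterior_form_eq_0_dependent[OF char_neq_2 V ext])
    show "set (map p vs) \<subseteq> span (B - {r})" using k vol(2) by (auto simp: p_def)
    show "card (B - {r}) < 1 + 2 * n" using B(1) cB finB by simp
  qed (use vol pV finB in auto)
  moreover have "?vol (map p vs) = ?vol vs"
    using ap wp vol by (intro volume_map[where S = V]) auto
  ultimately show False using vol(3) by simp
qed

text \<open>
  A Darboux list has even length, so it cannot span a space of odd dimension; a vector outside its
  span yields a nonzero vector of the radical of \<open>w\<close>. Because the volume form is nonzero, the form \<open>a\<close> does
  not vanish on it, and it can be rescaled.
\<close>
lemma reeb_vector_exists:
  assumes dim: "has_dim scale V (2 * n + 1)" and a: "linear_on scale (*) V a"
    and vol: "length vs = 2 * n + 1" "set vs \<subseteq> V"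
      "wedge 1 (2 * n) (form1 a) (wedge_power2 (form2 w) n) vs \<noteq> 0"
  shows "\<exists>x\<in>V. a x = 1 \<and> (\<forall>y\<in>V. w x y = 0)"
proof -
  obtain B where B: "finite B" "independent B" "span B = V" "card B = 2 * n + 1"
    using dim by (auto simp: has_dim_iff_basis)
  then obtain us where us: "darboux V w us"
      "\<And>x. x \<in> V \<Longrightarrow> \<exists>p\<in>span (set us). \<forall>y\<in>V. w (x - p) y = 0"
    using darboux_basis_exists[of B] by blast
  have ind: "independent (set us)" "distinct us" using darboux_independent us(1) by auto
  have span_sub: "span (set us) \<subseteq> V" using darboux_subset[OF us(1)] V by (rule span_minimal)
  have "\<not> V \<subseteq> span (set us)"
  proof
    assume "V \<subseteq> span (set us)"
    then have "card (set us) = 2 * n + 1"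
      using basis_card_eq_dim[OF darboux_subset[OF us(1)] _ ind(1)] dim by (simp add: has_dim_def)
    then show False using darboux_even[OF us(1)] ind(2) by (simp add: distinct_card)
  qed
  then obtain x where x: "x \<in> V" "x \<notin> span (set us)" by blast
  then obtain p where p: "p \<in> span (set us)" "\<forall>y\<in>V. w (x - p) y = 0" using us(2) by blast
  define r where "r = x - p"
  have r: "r \<in> V" "r \<noteq> 0" using x p(1) span_sub V by (auto simp: r_def intro: subspace_diff)
  have "a r \<noteq> 0" using volume_kernel_trivial[OF dim a vol r(1)] p(2) r(2) by (auto simp: r_def)
  then show ?thesis
    using r(1) p(2) V linear_onD(2)[OF a r(1)]
    by (intro bexI[of _ "scale (inverse (a r)) r"]) (auto simp: w_scale_left r_def subspace_scale)
qed

text \<open>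
  For a nondegenerate form a maximal Darboux list is a basis.
\<close>
lemma nondegenerate_imp_volume:
  assumes dim: "has_dim scale V (2 * n)"
    and nondeg: "\<And>x. x \<in> V \<Longrightarrow> (\<And>y. y \<in> V \<Longrightarrow> w x y = 0) \<Longrightarrow> x = 0"
  shows "\<exists>vs. length vs = 2 * n \<and> set vs \<subseteq> V \<and> wedge_power2 (form2 w) n vs = of_nat (fact n)"
proof -
  obtain B where B: "finite B" "span B = V" "card B = 2 * n"
    using dim by (auto simp: has_dim_iff_basis)
  then obtain us where us: "darboux V w us"
      "\<And>x. x \<in> V \<Longrightarrow> \<exists>p\<in>span (set us). \<forall>y\<in>V. w (x - p) y = 0"
    using darboux_basis_exists[of B] by blast
  have ind: "independent (set us)" "distinct us" using darboux_independent us(1) by auto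
  have sub: "set us \<subseteq> V" by (rule darboux_subset[OF us(1)])
  have span_sub: "span (set us) \<subseteq> V" using sub V by (rule span_minimal)
  have "V \<subseteq> span (set us)"
  proof
    fix x assume x: "x \<in> V"
    then obtain p where p: "p \<in> span (set us)" "\<forall>y\<in>V. w (x - p) y = 0" using us(2) by blast
    then have "x - p = 0" using nondeg[of "x - p"] x span_sub V by (auto intro: subspace_diff)
    then show "x \<in> span (set us)" using p(1) by simp
  qed
  then have "card (set us) = 2 * n"
    using basis_card_eq_dim[OF sub _ ind(1)] dim by (simp add: has_dim_def)
  then have "length us = 2 * n" using ind(2) by (simp add: distinct_card)
  then show ?thesis
    using sub wedge_power2_standard_pairing[OF _ darboux_standard_pairing[OF us(1)]] by blast
qed

end

section \<open>Algebras and their isomorphisms\<close>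

text \<open>
  A correspondence \<open>P\<close> that is total in both directions and matches \<open>r\<close> with \<open>r'\<close> induces a
  bijection of the classes. The map sends a class to everything that corresponds to one of its members,
  which avoids a choice of representatives.
\<close>
lemma bij_betw_quotients:
  fixes r :: "'i \<Rightarrow> 'i \<Rightarrow> bool" and r' :: "'j \<Rightarrow> 'j \<Rightarrow> bool"
  assumes rel: "\<And>x x' y y'. x \<in> S \<Longrightarrow> x' \<in> S \<Longrightarrow> y \<in> T \<Longrightarrow> y' \<in> T \<Longrightarrow> P x y \<Longrightarrow> P x' y' \<Longrightarrow> r x x' \<longleftrightarrow> r' y y'"
    and left: "\<And>x. x \<in> S \<Longrightarrow> \<exists>y\<in>T. P x y"
    and right: "\<And>y. y \<in> T \<Longrightarrow> \<exists>x\<in>S. P x y"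
  shows "bij_betw (\<lambda>C. {y \<in> T. \<exists>x\<in>C. P x y})
    (S // {(x, x'). x \<in> S \<and> x' \<in> S \<and> r x x'}) (T // {(y, y'). y \<in> T \<and> y' \<in> T \<and> r' y y'})"
proof -
  let ?R = "{(x, x'). x \<in> S \<and> x' \<in> S \<and> r x x'}"
  let ?R' = "{(y, y'). y \<in> T \<and> y' \<in> T \<and> r' y y'}"
  let ?F = "\<lambda>C. {y \<in> T. \<exists>x\<in>C. P x y}"
  have F: "?F (?R `` {x}) = ?R' `` {y}" if "x \<in> S" "y \<in> T" "P x y" for x y
    using that rel right by auto blast
  show ?thesis
    unfolding bij_betw_def
  proof
    show "inj_on ?F (S // ?R)"
    proof (rule inj_onI)
      fix C D assume "C \<in> S // ?R" "D \<in> S // ?R" and eq: "?F C = ?F D"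
      then obtain c d where cd: "c \<in> S" "C = ?R `` {c}" "d \<in> S" "D = ?R `` {d}"
        by (auto simp: quotient_def)
      obtain c' d' where cd': "c' \<in> T" "P c c'" "d' \<in> T" "P d d'" using left cd by blast
      have "?R' `` {c'} = ?R' `` {d'}" using eq F cd cd' by simp
      then have "r' c' y \<longleftrightarrow> r' d' y" if "y \<in> T" for y using that cd' by blast
      then have "r c x \<longleftrightarrow> r d x" if "x \<in> S" for x using left[OF that] rel cd cd' that by blast
      then show "C = D" using cd by auto
    qed
    show "?F ` (S // ?R) = T // ?R'"
    proof (intro equalityI subsetI)
      fix D assume "D \<in> ?F ` (S // ?R)"
      then obtain x where x: "x \<in> S" "D = ?F (?R `` {x})" by (auto simp: quotient_def)
      obtain y where y: "y \<in> T" "P x y" using left[OF x(1)] by blast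
      have "D = ?R' `` {y}" using F x y by simp
      then show "D \<in> T // ?R'" using y(1) by (simp only: quotientI)
    next
      fix D assume "D \<in> T // ?R'"
      then obtain y where y: "y \<in> T" "D = ?R' `` {y}" by (auto simp: quotient_def)
      obtain x where x: "x \<in> S" "P x y" using right[OF y(1)] by blast
      have "D = ?F (?R `` {x})" using F x y by simp
      then show "D \<in> ?F ` (S // ?R)" using x(1) by (blast intro: quotientI)
    qed
  qed
qed

lemma of_nat_fact_neq_0:
  assumes "CHAR('k::field) = 0 \<or> n < CHAR('k)"
  shows "of_nat (fact n) \<noteq> (0 :: 'k)"
proof
  assume "of_nat (fact n) = (0 :: 'k)"
  then have dvd: "CHAR('k) dvd fact n" by (simp only: of_nat_eq_0_iff_char_dvd)
  show False
  proof (cases "CHAR('k) = 0")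
    case False
    then have "prime (CHAR('k))" by (simp add: prime_CHAR_semidom)
    then show False using dvd False assms by (simp add: prime_dvd_fact_iff)
  qed (use dvd in simp)
qed

context jj_algebra
begin

sublocale vs: vector_space "scl A"
  using has_dim by (simp add: has_dim_def)

lemma subspace: "vs.subspace (car A)"
  using has_dim by (simp add: has_dim_def)

lemma zero_closed [simp]: "0 \<in> car A"
  using subspace by (rule vs.subspace_0)

lemma add_closed [simp]: "x \<in> car A \<Longrightarrow> y \<in> car A \<Longrightarrow> x + y \<in> car A"
  using subspace by (rule vs.subspace_add)

lemma diff_closed [simp]: "x \<in> car A \<Longrightarrow> y \<in> car A \<Longrightarrow> x - y \<in> car A"
  using subspace by (rule vs.subspace_diff)

lemma neg_closed [simp]: "x \<in> car A \<Longrightarrow> - x \<in> car A"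
  using subspace by (rule vs.subspace_neg)

lemma scl_closed [simp]: "x \<in> car A \<Longrightarrow> scl A c x \<in> car A"
  using subspace by (rule vs.subspace_scale)

declare mul_closed [simp]

lemma mul_add_left: "x \<in> car A \<Longrightarrow> y \<in> car A \<Longrightarrow> z \<in> car A \<Longrightarrow> mul A (x + y) z = mul A x z + mul A y z"
  using mul_bilinear by (auto simp: bilinear_on_def linear_on_def)

lemma mul_add_right: "x \<in> car A \<Longrightarrow> y \<in> car A \<Longrightarrow> z \<in> car A \<Longrightarrow> mul A z (x + y) = mul A z x + mul A z y"
  using mul_bilinear by (auto simp: bilinear_on_def linear_on_def)

lemma mul_scl_left: "x \<in> car A \<Longrightarrow> z \<in> car A \<Longrightarrow> mul A (scl A c x) z = scl A c (mul A x z)"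
  using mul_bilinear by (auto simp: bilinear_on_def linear_on_def)

lemma mul_scl_right: "x \<in> car A \<Longrightarrow> z \<in> car A \<Longrightarrow> mul A z (scl A c x) = scl A c (mul A z x)"
  using mul_bilinear by (auto simp: bilinear_on_def linear_on_def)

lemma mul_zero_left [simp]: "z \<in> car A \<Longrightarrow> mul A 0 z = 0"
  using mul_scl_left[of 0 z 0] by simp

lemma mul_zero_right [simp]: "z \<in> car A \<Longrightarrow> mul A z 0 = 0"
  using mul_scl_right[of 0 z 0] by simp

lemma skew_space:
  assumes "skew_form A w" "CHAR('k) \<noteq> 2"
  shows "skew_space (scl A) (car A) w"
  using assms subspace unfolding skew_form_def by unfold_locales blast+

end

lemma alg_isoD:
  assumes "alg_iso A B f"
  shows "bij_betw f (car A) (car B)"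
    and "x \<in> car A \<Longrightarrow> f x \<in> car B"
    and "f ` car A = car B"
    and "x \<in> car A \<Longrightarrow> y \<in> car A \<Longrightarrow> f (x + y) = f x + f y"
    and "x \<in> car A \<Longrightarrow> f (scl A c x) = scl B c (f x)"
    and "x \<in> car A \<Longrightarrow> y \<in> car A \<Longrightarrow> f (mul A x y) = mul B (f x) (f y)"
  using assms by (auto simp: alg_iso_def linear_on_def bij_betw_def)

lemma alg_iso_trans:
  assumes "alg_iso A B f" "alg_iso B C g"
  shows "alg_iso A C (g \<circ> f)"
  using alg_isoD(2,4-6)[OF assms(1)] alg_isoD(2,4-6)[OF assms(2)]
    bij_betw_trans[OF alg_isoD(1)[OF assms(1)] alg_isoD(1)[OF assms(2)]]
  by (auto simp: alg_iso_def linear_on_def)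

lemma (in jj_algebra) alg_iso_sym:
  assumes f: "alg_iso A B f"
  shows "alg_iso B A (inv_into (car A) f)"
    and "x \<in> car A \<Longrightarrow> inv_into (car A) f (f x) = x"
proof -
  show inv: "inv_into (car A) f (f x) = x" if "x \<in> car A" for x
    using that alg_isoD(1)[OF f] by (simp add: bij_betw_def)
  note hom = alg_isoD(4-6)[OF f, symmetric]
  show "alg_iso B A (inv_into (car A) f)"
    unfolding alg_iso_def linear_on_def alg_isoD(3)[OF f, symmetric]
    using bij_betw_inv_into[OF alg_isoD(1)[OF f], folded alg_isoD(3)[OF f]]
    by (auto simp: hom inv)
qed

lemma (in jj_algebra) alg_iso_0:
  assumes "alg_iso A B f" "vector_space (scl B)"
  shows "f 0 = 0"
proof -
  interpret B: vector_space "scl B" by fact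
  show ?thesis using alg_isoD(5)[OF assms(1) zero_closed, of 0] by simp
qed

text \<open>
  Structures can be moved along isomorphisms: every identity in \<open>B\<close> is the image under \<open>f\<close> of the
  identity in \<open>A\<close>, since \<open>f\<close> maps onto the carrier of \<open>B\<close>.
\<close>
lemma (in jj_algebra) jj_algebra_transport:
  assumes f: "alg_iso A B f" and "vector_space (scl B)"
  shows "jj_algebra d B"
proof -
  note hom = alg_isoD(4-6)[OF f, symmetric]
  note car = alg_isoD(3)[OF f, symmetric]
  show ?thesis
  proof
    show "has_dim (scl B) (car B) d"
      unfolding car using f assms(2)
      by (intro has_dim_image[OF has_dim]) (auto simp: alg_iso_def bij_betw_def)
    show "bilinear_on (scl B) (scl B) (car B) (mul B)"
      unfolding car bilinear_on_def linear_on_def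
      by (auto simp: hom mul_add_left mul_add_right mul_scl_left mul_scl_right)
  next
    fix x y assume "x \<in> car B" "y \<in> car B"
    then show "mul B x y \<in> car B" "mul B x y = mul B y x"
      unfolding car by (auto simp: hom mul_commute)
  next
    fix x y z assume "x \<in> car B" "y \<in> car B" "z \<in> car B"
    then show "mul B x (mul B y z) + mul B y (mul B z x) + mul B z (mul B x y) = 0"
      unfolding car by (auto simp: hom jacobi alg_iso_0[OF assms])
  qed
qed

lemma (in jj_algebra) forms_transport:
  assumes f: "alg_iso A B f"
    and w: "\<And>x y. x \<in> car A \<Longrightarrow> y \<in> car A \<Longrightarrow> w' (f x) (f y) = w x y"
  shows "skew_form A w \<Longrightarrow> skew_form B w'" and "closed_form A w \<Longrightarrow> closed_form B w'"
proof -
  note hom = alg_isoD(4-6)[OF f, symmetric]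
  note car = alg_isoD(3)[OF f, symmetric]
  show "skew_form B w'" if "skew_form A w"
  proof -
    have "bilinear_on (scl A) (*) (car A) w" using that by (simp add: skew_form_def)
    then have "bilinear_on (scl B) (*) (car B) w'"
      unfolding bilinear_on_def linear_on_def car by (auto simp: hom w)
    moreover have "w' (f x) (f y) = - w' (f y) (f x)" if "x \<in> car A" "y \<in> car A" for x y
      using \<open>skew_form A w\<close> that w unfolding skew_form_def by metis
    ultimately show ?thesis unfolding skew_form_def car by blast
  qed
  show "closed_form B w'" if "closed_form A w"
    using that unfolding closed_form_def car by (auto simp: hom w)
qed

lemma symp_iso_trans [trans]:
  assumes "symp_iso H H'" "symp_iso H' H''"
  shows "symp_iso H H''"
proof -
  obtain f where f: "alg_iso H H' f"
    "\<And>x y. x \<in> car H \<Longrightarrow> y \<in> car H \<Longrightarrow> sform H' (f x) (f y) = sform H x y"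
    "\<And>x. x \<in> car H \<Longrightarrow> f (der H x) = der H' (f x)"
    using assms(1) unfolding symp_iso_def by blast
  obtain g where g: "alg_iso H' H'' g"
    "\<And>x y. x \<in> car H' \<Longrightarrow> y \<in> car H' \<Longrightarrow> sform H'' (g x) (g y) = sform H' x y"
    "\<And>x. x \<in> car H' \<Longrightarrow> g (der H' x) = der H'' (g x)"
    using assms(2) unfolding symp_iso_def by blast
  show ?thesis
    unfolding symp_iso_def
    using alg_iso_trans[OF f(1) g(1)] f g alg_isoD(2)[OF f(1)] by (intro exI[of _ "g \<circ> f"]) simp
qed

lemma cosymp_iso_trans [trans]:
  assumes "cosymp_iso J J'" "cosymp_iso J' J''"
  shows "cosymp_iso J J''"
proof -
  obtain f where f: "alg_iso J J' f"
    "\<And>x y. x \<in> car J \<Longrightarrow> y \<in> car J \<Longrightarrow> omega J' (f x) (f y) = omega J x y"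
    "\<And>x. x \<in> car J \<Longrightarrow> alpha J' (f x) = alpha J x"
    using assms(1) unfolding cosymp_iso_def by blast
  obtain g where g: "alg_iso J' J'' g"
    "\<And>x y. x \<in> car J' \<Longrightarrow> y \<in> car J' \<Longrightarrow> omega J'' (g x) (g y) = omega J' x y"
    "\<And>x. x \<in> car J' \<Longrightarrow> alpha J'' (g x) = alpha J' x"
    using assms(2) unfolding cosymp_iso_def by blast
  show ?thesis
    unfolding cosymp_iso_def
    using alg_iso_trans[OF f(1) g(1)] f g alg_isoD(2)[OF f(1)] by (intro exI[of _ "g \<circ> f"]) simp
qed

lemma (in symplectic_jj_algebra_der) der_closed [simp]: "x \<in> car H \<Longrightarrow> der H x \<in> car H"
  using der_anti_derivation by (auto simp: anti_derivation_def)

lemma (in symplectic_jj_algebra_der) der_linear: "linear_on (scl H) (scl H) (car H) (der H)"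
  using der_anti_derivation by (auto simp: anti_derivation_def)

lemmas (in symplectic_jj_algebra_der) der_add = linear_onD(1)[OF der_linear]
  and der_scl = linear_onD(2)[OF der_linear]

lemma (in symplectic_jj_algebra_der) der_0 [simp]: "der H 0 = 0"
  using der_scl[of 0 0] by simp

lemma (in symplectic_jj_algebra_der) der_mul:
  "x \<in> car H \<Longrightarrow> y \<in> car H \<Longrightarrow> der H (mul H x y) = - mul H (der H x) y - mul H x (der H y)"
  using der_anti_derivation by (auto simp: anti_derivation_def)

lemma (in symplectic_jj_algebra_der) symp_iso_sym:
  assumes "symp_iso H H'"
  shows "symp_iso H' H"
proof -
  obtain f where f: "alg_iso H H' f"
    "\<And>x y. x \<in> car H \<Longrightarrow> y \<in> car H \<Longrightarrow> sform H' (f x) (f y) = sform H x y"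
    "\<And>x. x \<in> car H \<Longrightarrow> der H' (f x) = f (der H x)"
    using assms unfolding symp_iso_def by metis
  have car: "car H' = f ` car H" using alg_isoD(3)[OF f(1)] by simp
  show ?thesis
    unfolding symp_iso_def
  proof (intro exI conjI ballI)
    show "alg_iso H' H (inv_into (car H) f)" by (rule alg_iso_sym(1)[OF f(1)])
  qed (auto simp: car f(2,3) alg_iso_sym(2)[OF f(1)])
qed

lemma cosymp_iso_sym:
  assumes "jj_algebra d J" "cosymp_iso J J'"
  shows "cosymp_iso J' J"
proof -
  interpret jj_algebra d J by fact
  obtain f where f: "alg_iso J J' f"
    "\<And>x y. x \<in> car J \<Longrightarrow> y \<in> car J \<Longrightarrow> omega J' (f x) (f y) = omega J x y"
    "\<And>x. x \<in> car J \<Longrightarrow> alpha J' (f x) = alpha J x"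
    using assms(2) unfolding cosymp_iso_def by metis
  have car: "car J' = f ` car J" using alg_isoD(3)[OF f(1)] by simp
  show ?thesis
    unfolding cosymp_iso_def
  proof (intro exI conjI ballI)
    show "alg_iso J' J (inv_into (car J) f)" by (rule alg_iso_sym(1)[OF f(1)])
  qed (auto simp: car f(2,3) alg_iso_sym(2)[OF f(1)])
qed

lemma (in symplectic_jj_algebra_der) symplectic_transport:
  assumes iso: "symp_iso H H'" and "vector_space (scl H')"
  shows "symplectic_jj_algebra_der n H'"
proof -
  obtain f where f: "alg_iso H H' f"
    "\<And>x y. x \<in> car H \<Longrightarrow> y \<in> car H \<Longrightarrow> sform H' (f x) (f y) = sform H x y"
    "\<And>x. x \<in> car H \<Longrightarrow> der H' (f x) = f (der H x)"
    using iso unfolding symp_iso_def by metis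
  interpret H': jj_algebra "2 * n" H' using jj_algebra_transport[OF f(1) assms(2)] .
  note car = alg_isoD(3)[OF f(1), symmetric]
  note hom = alg_isoD(4-6)[OF f(1), symmetric]
  note f0 = alg_iso_0[OF f(1) assms(2)]
  have neg: "- f x = f (- x)" if "x \<in> car H" for x
    using alg_isoD(4)[OF f(1) that neg_closed[OF that]] f0 by (simp add: add_eq_0_iff)
  have diff: "f x - f y = f (x - y)" if "x \<in> car H" "y \<in> car H" for x y
    using alg_isoD(4)[OF f(1) diff_closed[OF that] that(2)] by simp
  show ?thesis
  proof
    show "skew_form H' (sform H')" "closed_form H' (sform H')"
      using forms_transport[OF f(1), where w = "sform H" and w' = "sform H'"] f(2) sform_skew sform_closed
      by blast+
    show "anti_derivation H' (der H')"
      unfolding anti_derivation_def linear_on_def car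
      by (auto simp: hom f(3) der_add der_scl der_mul neg diff)
  next
    fix x assume x: "x \<in> car H'" "\<forall>y\<in>car H'. sform H' x y = 0"
    then obtain u where u: "u \<in> car H" "x = f u" unfolding car by auto
    have "u = 0"
      using x u f(2) sform_nondegenerate[OF u(1)] unfolding car by auto
    then show "x = 0" using u(2) f0 by simp
  next
    fix x assume "x \<in> car H'"
    then show "der H' (der H' x) = 0" unfolding car by (auto simp: f(3) der_square f0)
  next
    fix x y assume "x \<in> car H'" "y \<in> car H'"
    then show "sform H' (der H' x) y = sform H' x (der H' y)"
      unfolding car by (auto simp: f(2,3) der_sform)
  qed
qed

lemma (in cosymplectic_jj_algebra) cosymplectic_transport:
  assumes iso: "cosymp_iso J J'" and "vector_space (scl J')"
  shows "cosymplectic_jj_algebra n J'"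
proof -
  obtain f where f: "alg_iso J J' f"
    "\<And>x y. x \<in> car J \<Longrightarrow> y \<in> car J \<Longrightarrow> omega J' (f x) (f y) = omega J x y"
    "\<And>x. x \<in> car J \<Longrightarrow> alpha J' (f x) = alpha J x"
    using iso unfolding cosymp_iso_def by metis
  interpret J': jj_algebra "2 * n + 1" J' using jj_algebra_transport[OF f(1) assms(2)] .
  note car = alg_isoD(3)[OF f(1), symmetric]
  note hom = alg_isoD(4-6)[OF f(1), symmetric]
  obtain vs where vs: "length vs = 2 * n + 1" "set vs \<subseteq> car J"
      "wedge 1 (2 * n) (form1 (alpha J)) (wedge_power2 (form2 (omega J)) n) vs \<noteq> 0"
    using volume by blast
  show ?thesis
  proof
    show "skew_form J' (omega J')" "closed_form J' (omega J')"
      using forms_transport[OF f(1), where w = "omega J" and w' = "omega J'"] f(2) omega_skew omega_closed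
      by blast+
    show "linear_on (scl J') (*) (car J') (alpha J')"
      using alpha_linear unfolding linear_on_def car by (auto simp: hom f(3))
    show "\<exists>vs. length vs = 2 * n + 1 \<and> set vs \<subseteq> car J' \<and>
      wedge 1 (2 * n) (form1 (alpha J')) (wedge_power2 (form2 (omega J')) n) vs \<noteq> 0"
    proof (intro exI conjI)
      show "wedge 1 (2 * n) (form1 (alpha J')) (wedge_power2 (form2 (omega J')) n) (map f vs) \<noteq> 0"
        by (subst volume_map[where S = "car J" and a = "alpha J" and w = "omega J"]) (use vs f(2,3) in auto)
    qed (use vs car in auto)
  next
    fix x y assume "x \<in> car J'" "y \<in> car J'"
    then show "alpha J' (mul J' x y) = 0" unfolding car by (auto simp: hom f(3) alpha_closed)
  qed
qed

lemma reeb_equality: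
  assumes "\<exists>!\<xi>. is_reeb J \<xi>"
  shows "is_reeb J (reeb J)" and "is_reeb J \<xi> \<Longrightarrow> reeb J = \<xi>"
  using assms unfolding reeb_def by (auto intro: theI' the1_equality)

section \<open>From cosymplectic to symplectic algebras\<close>

text \<open>
  Uniqueness of the Reeb vector forces an isomorphism to respect it, hence to intertwine the
  multiplications by it. The hypotheses are this uniqueness rather than the cosymplectic
  axioms, so as to cover extensions whose volume form vanishes in small characteristic.
\<close>
lemma symp_iso_reduction:
  assumes J: "\<exists>!\<xi>. is_reeb J \<xi>" and J': "\<exists>!\<xi>. is_reeb J' \<xi>" and iso: "cosymp_iso J J'"
  shows "symp_iso (reduction J) (reduction J')"
proof -
  obtain f where f: "alg_iso J J' f"
    "\<And>x y. x \<in> car J \<Longrightarrow> y \<in> car J \<Longrightarrow> omega J' (f x) (f y) = omega J x y"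
    "\<And>x. x \<in> car J \<Longrightarrow> alpha J' (f x) = alpha J x"
    using iso unfolding cosymp_iso_def by metis
  note car = alg_isoD(3)[OF f(1), symmetric]
  have reeb: "reeb J \<in> car J" using reeb_equality(1)[OF J] by (simp add: is_reeb_def)
  have "is_reeb J' (f (reeb J))"
    using reeb_equality(1)[OF J] f unfolding is_reeb_def car by auto
  then have reeb': "reeb J' = f (reeb J)" by (rule reeb_equality(2)[OF J'])
  have "bij_betw f {x \<in> car J. alpha J x = 0} {x \<in> car J'. alpha J' x = 0}"
    using alg_isoD(1)[OF f(1)] f(3) unfolding car by (auto simp: bij_betw_def inj_on_def)
  then have "alg_iso (reduction J) (reduction J') f"
    using alg_isoD(4-6)[OF f(1)] by (auto simp: alg_iso_def linear_on_def reduction_def)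
  then show ?thesis
    unfolding symp_iso_def
    using f(2) alg_isoD(6)[OF f(1) reeb] reeb' by (intro exI[of _ f]) (simp add: reduction_def)
qed

lemma prod_scale:
  assumes "vector_space (s :: 'k::field \<Rightarrow> 'v::ab_group_add \<Rightarrow> 'v)"
  shows "vector_space (module_prod.scale s ((*) :: 'k \<Rightarrow> 'k \<Rightarrow> 'k))"
    and "module_prod.scale s (*) c (x, a) = (s c x, c * a)"
proof -
  interpret s: vector_space s by fact
  interpret k: vector_space "(*) :: 'k \<Rightarrow> 'k \<Rightarrow> 'k" by unfold_locales (auto simp: algebra_simps)
  interpret p: vector_space_prod s "(*) :: 'k \<Rightarrow> 'k \<Rightarrow> 'k" by unfold_locales
  show "vector_space (module_prod.scale s ((*) :: 'k \<Rightarrow> 'k \<Rightarrow> 'k))" by (rule p.p.vector_space_axioms)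
  show "module_prod.scale s (*) c (x, a) = (s c x, c * a)" by (rule p.scale_prod)
qed

context cosymplectic_jj_algebra
begin

lemma alpha_add: "x \<in> car J \<Longrightarrow> y \<in> car J \<Longrightarrow> alpha J (x + y) = alpha J x + alpha J y"
  and alpha_scl: "x \<in> car J \<Longrightarrow> alpha J (scl J c x) = c * alpha J x"
  using linear_onD[OF alpha_linear] by auto

lemma alpha_0 [simp]: "alpha J 0 = 0"
  using alpha_scl[of 0 0] by simp

lemma alpha_diff: "x \<in> car J \<Longrightarrow> y \<in> car J \<Longrightarrow> alpha J (x - y) = alpha J x - alpha J y"
  using alpha_add[of "x - y" y] by simp

lemma radical_trivial:
  assumes "CHAR('k) \<noteq> 2" "x \<in> car J" "alpha J x = 0" "\<And>y. y \<in> car J \<Longrightarrow> omega J x y = 0"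
  shows "x = 0"
proof -
  interpret w: skew_space "scl J" "car J" "omega J" using skew_space[OF omega_skew assms(1)] .
  show ?thesis
    using volume w.volume_kernel_trivial[OF has_dim alpha_linear] assms(2-) by blast
qed

lemma reeb_unique:
  assumes char: "CHAR('k) \<noteq> 2"
  shows "\<exists>!\<xi>. is_reeb J \<xi>"
proof -
  interpret w: skew_space "scl J" "car J" "omega J" using skew_space[OF omega_skew char] .
  obtain \<xi> where \<xi>: "is_reeb J \<xi>"
    using volume w.reeb_vector_exists[OF has_dim alpha_linear] unfolding is_reeb_def by blast
  have "\<eta> = \<xi>" if "is_reeb J \<eta>" for \<eta>
  proof -
    have "\<eta> - \<xi> = 0"
      using \<xi> that by (intro radical_trivial[OF char]) (auto simp: is_reeb_def alpha_diff w.w_diff_left)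
    then show ?thesis by simp
  qed
  then show ?thesis using \<xi> by blast
qed

context
  assumes char: "CHAR('k) \<noteq> 2"
begin

interpretation w: skew_space "scl J" "car J" "omega J"
  using skew_space[OF omega_skew char] .

lemma is_reeb_reeb: "is_reeb J (reeb J)"
  using reeb_equality(1)[OF reeb_unique[OF char]] .

lemma reeb_closed [simp]: "reeb J \<in> car J"
  and alpha_reeb [simp]: "alpha J (reeb J) = 1"
  and omega_reeb_left [simp]: "y \<in> car J \<Longrightarrow> omega J (reeb J) y = 0"
  using is_reeb_reeb by (auto simp: is_reeb_def)

lemma omega_reeb_right [simp]: "y \<in> car J \<Longrightarrow> omega J y (reeb J) = 0"
  using w.skew[of y "reeb J"] by simp

lemma omega_mul: "x \<in> car J \<Longrightarrow> y \<in> car J \<Longrightarrow> z \<in> car J \<Longrightarrow>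
    omega J (mul J x y) z + omega J (mul J z x) y + omega J (mul J y z) x = 0"
  using omega_closed by (simp add: closed_form_def)

text \<open>
  By closedness \<open>\<omega>(\<xi> \<cdot> \<xi>, y)\<close> reduces to values \<open>\<omega>(_, \<xi>) = 0\<close>, and \<open>\<alpha>(\<xi> \<cdot> \<xi>) = 0\<close>.
\<close>
lemma reeb_square: "mul J (reeb J) (reeb J) = 0"
proof (rule radical_trivial[OF char])
  fix y assume "y \<in> car J"
  then show "omega J (mul J (reeb J) (reeb J)) y = 0"
    using omega_mul[of "reeb J" "reeb J" y] by simp
qed (simp_all add: alpha_closed)

text \<open>
  Write \<open>D x = \<xi> \<cdot> x\<close>. The Jacobi identity for \<open>\<xi>, x, y\<close> says that \<open>D\<close> is an anti-derivation, and for
  \<open>\<xi>, \<xi>, x\<close> it reads \<open>2 D\<^sup>2 x + x \<cdot> (\<xi> \<cdot> \<xi>) = 0\<close>, so \<open>D\<^sup>2 = 0\<close>. Closedness of \<open>\<omega>\<close> on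
  \<open>x, y, \<xi>\<close> says that \<open>D\<close> is self-adjoint. The form is nondegenerate on the kernel of \<open>\<alpha>\<close>, because
  a vector there that is orthogonal to the kernel is also orthogonal to \<open>\<xi>\<close> and hence lies in the
  radical.
\<close>
lemma reduction_symplectic: "symplectic_jj_algebra_der n (reduction J)"
proof -
  let ?U = "{x \<in> car J. alpha J x = 0}"
  let ?\<xi> = "reeb J"
  have sub: "vs.subspace ?U"
    by (rule vs.subspaceI) (auto simp: alpha_add alpha_scl)
  have dim: "has_dim (scl J) ?U (2 * n)"
  proof (rule has_dim_hyperplane)
    show "\<exists>c. v - scl J c ?\<xi> \<in> ?U" if "v \<in> car J" for v
      using that by (intro exI[of _ "alpha J v"]) (simp add: alpha_diff alpha_scl)
  qed (use has_dim sub in auto)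
  have sel: "scl (reduction J) = scl J" "car (reduction J) = ?U" "mul (reduction J) = mul J"
    "sform (reduction J) = omega J" "der (reduction J) = mul J ?\<xi>"
    by (simp_all add: reduction_def fun_eq_iff)
  have two: "x = 0" if "x + x = 0" for x :: 'v
  proof -
    have "scl J 2 x = 0" using that vs.scale_left_distrib[of 1 1 x] by simp
    moreover have "(2 :: 'k) \<noteq> 0"
      using eq_minus_self_imp_0[OF char, of 1] by (metis add_eq_0_iff one_add_one zero_neq_one)
    ultimately show ?thesis by simp
  qed
  show ?thesis
  proof (unfold_locales, unfold sel)
    show "has_dim (scl J) ?U (2 * n)" by (rule dim)
    show "bilinear_on (scl J) (scl J) ?U (mul J)"
      using mul_bilinear by (auto simp: bilinear_on_def linear_on_def)
    show "skew_form (reduction J) (omega J)"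
      using omega_skew unfolding skew_form_def bilinear_on_def linear_on_def sel by blast
    show "closed_form (reduction J) (omega J)"
      using omega_closed unfolding closed_form_def sel by blast
    show "anti_derivation (reduction J) (mul J ?\<xi>)"
      unfolding anti_derivation_def linear_on_def sel
    proof (intro conjI ballI allI)
      fix x y assume xy: "x \<in> ?U" "y \<in> ?U"
      have "mul J ?\<xi> (mul J x y) + mul J x (mul J y ?\<xi>) + mul J y (mul J ?\<xi> x) = 0"
        using xy by (intro jacobi) auto
      moreover have "mul J x (mul J y ?\<xi>) = mul J x (mul J ?\<xi> y)"
        "mul J y (mul J ?\<xi> x) = mul J (mul J ?\<xi> x) y"
        using xy by (auto simp: mul_commute)
      ultimately show "mul J ?\<xi> (mul J x y) = - mul J (mul J ?\<xi> x) y - mul J x (mul J ?\<xi> y)"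
        by (simp add: algebra_simps eq_neg_iff_add_eq_0)
    qed (auto simp: alpha_closed mul_add_right mul_scl_right)
  next
    fix x y assume "x \<in> ?U" "y \<in> ?U"
    then show "mul J x y \<in> ?U" "mul J x y = mul J y x" by (auto simp: alpha_closed mul_commute)
  next
    fix x y z assume "x \<in> ?U" "y \<in> ?U" "z \<in> ?U"
    then show "mul J x (mul J y z) + mul J y (mul J z x) + mul J z (mul J x y) = 0"
      by (simp add: jacobi)
  next
    fix x assume x: "x \<in> ?U" "\<forall>y\<in>?U. omega J x y = 0"
    show "x = 0"
    proof (rule radical_trivial[OF char])
      fix y assume y: "y \<in> car J"
      define u where "u = y - scl J (alpha J y) ?\<xi>"
      have u: "u \<in> ?U" using y by (simp add: u_def alpha_diff alpha_scl)
      have "omega J x y = omega J x u + omega J x (scl J (alpha J y) ?\<xi>)"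
        using w.w_add_right[of u "scl J (alpha J y) ?\<xi>" x] u x(1) by (simp add: u_def)
      then show "omega J x y = 0" using x u by (simp add: w.w_scale_right)
    qed (use x in auto)
  next
    fix x assume x: "x \<in> ?U"
    then have "mul J ?\<xi> (mul J ?\<xi> x) + mul J ?\<xi> (mul J x ?\<xi>) + mul J x (mul J ?\<xi> ?\<xi>) = 0"
      by (intro jacobi) auto
    then show "mul J ?\<xi> (mul J ?\<xi> x) = 0"
      using x by - (rule two, simp add: reeb_square mul_commute[of x ?\<xi>])
  next
    fix x y assume xy: "x \<in> ?U" "y \<in> ?U"
    have "omega J (mul J x y) ?\<xi> + omega J (mul J ?\<xi> x) y + omega J (mul J y ?\<xi>) x = 0"
      using xy by (intro omega_mul) auto
    then show "omega J (mul J ?\<xi> x) y = omega J x (mul J ?\<xi> y)"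
      using xy w.skew[of x "mul J ?\<xi> y"] by (simp add: mul_commute[of y] add_eq_0_iff)
  qed
qed

text \<open>
  The decomposition \<open>x = (x - \<alpha>(x) \<xi>) + \<alpha>(x) \<xi>\<close>; the products agree since \<open>\<xi> \<cdot> \<xi> = 0\<close>.
\<close>
lemma extension_reduction_iso: "cosymp_iso (extension (reduction J)) J"
proof -
  let ?U = "{x \<in> car J. alpha J x = 0}"
  let ?\<xi> = "reeb J"
  let ?E = "extension (reduction J)"
  define f where "f = (\<lambda>(x, a). x + scl J a ?\<xi>)"
  note scale = prod_scale(2)[OF vs.vector_space_axioms]
  have f: "f (x, a) = x + scl J a ?\<xi>" for x a by (simp add: f_def)
  have car: "car ?E = ?U \<times> UNIV" by (simp add: extension_def reduction_def)
  have "bij_betw f (?U \<times> UNIV) (car J)"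
    by (rule bij_betw_byWitness[where f' = "\<lambda>x. (x - scl J (alpha J x) ?\<xi>, alpha J x)"])
      (auto simp: f alpha_add alpha_scl alpha_diff)
  moreover have "linear_on (scl ?E) (scl J) (car ?E) f"
    unfolding linear_on_def car
    by (auto simp: f extension_def reduction_def scale vs.scale_left_distrib vs.scale_right_distrib)
  moreover have "f (mul ?E p q) = mul J (f p) (f q)" if "p \<in> car ?E" "q \<in> car ?E" for p q
  proof -
    obtain x a y b where pq: "p = (x, a)" "q = (y, b)" by (cases p, cases q)
    then have xy: "x \<in> ?U" "y \<in> ?U" using that car by auto
    have "f (mul ?E p q) = mul J x y + scl J a (mul J ?\<xi> y) + scl J b (mul J ?\<xi> x)"
      by (simp add: pq f extension_def reduction_def)
    also have "\<dots> = mul J (f p) (f q)"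
      using xy
      by (simp add: pq f mul_add_left mul_add_right mul_scl_left mul_scl_right reeb_square
          mul_commute[of x ?\<xi>])
    finally show ?thesis .
  qed
  ultimately have "alg_iso ?E J f" by (simp add: alg_iso_def car)
  moreover have "alpha J (f p) = alpha ?E p" if "p \<in> car ?E" for p
    using that unfolding car by (auto simp: f alpha_add alpha_scl extension_def)
  moreover have "omega J (f p) (f q) = omega ?E p q" if "p \<in> car ?E" "q \<in> car ?E" for p q
    using that unfolding car
    by (auto simp: f extension_def reduction_def w.w_add_left w.w_add_right w.w_scale_left w.w_scale_right)
  ultimately show ?thesis unfolding cosymp_iso_def by blast
qed

end

end

section \<open>From symplectic to cosymplectic algebras\<close>

lemma extension_simps:
  "scl (extension H) = module_prod.scale (scl H) (*)"
  "car (extension H) = car H \<times> UNIV"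
  "mul (extension H) (x, a) (y, b) = (mul H x y + scl H a (der H y) + scl H b (der H x), 0)"
  "alpha (extension H) = snd"
  "omega (extension H) (x, a) (y, b) = sform H x y"
  by (simp_all add: extension_def)

context symplectic_jj_algebra_der
begin

lemma sform_linear:
  "x \<in> car H \<Longrightarrow> y \<in> car H \<Longrightarrow> z \<in> car H \<Longrightarrow> sform H (x + y) z = sform H x z + sform H y z"
  "x \<in> car H \<Longrightarrow> y \<in> car H \<Longrightarrow> z \<in> car H \<Longrightarrow> sform H z (x + y) = sform H z x + sform H z y"
  "x \<in> car H \<Longrightarrow> z \<in> car H \<Longrightarrow> sform H (scl H c x) z = c * sform H x z"
  "x \<in> car H \<Longrightarrow> z \<in> car H \<Longrightarrow> sform H z (scl H c x) = c * sform H z x"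
  using sform_skew unfolding skew_form_def bilinear_on_def linear_on_def by blast+

lemma sform_swap: "x \<in> car H \<Longrightarrow> y \<in> car H \<Longrightarrow> sform H x y = - sform H y x"
  using sform_skew unfolding skew_form_def by blast

lemma sform_0_left [simp]: "y \<in> car H \<Longrightarrow> sform H 0 y = 0"
  using sform_linear(3)[of 0 y 0] by simp

text \<open>
  A Reeb vector \<open>(x, 1)\<close> has \<open>x\<close> in the radical of the form of \<open>H\<close>, hence \<open>x = 0\<close>.
\<close>
lemma is_reeb_extension_iff: "is_reeb (extension H) \<xi> \<longleftrightarrow> \<xi> = (0, 1)"
proof (cases \<xi>)
  case (Pair x a)
  then show ?thesis
    using sform_nondegenerate[of x] by (auto simp: is_reeb_def extension_simps)
qed

lemma extension_reeb_unique: "\<exists>!\<xi>. is_reeb (extension H) \<xi>"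
  by (simp add: is_reeb_extension_iff)

lemma reeb_extension: "reeb (extension H) = (0, 1)"
  using reeb_equality(2)[OF extension_reeb_unique] by (simp add: is_reeb_extension_iff)

text \<open>
  Stated with \<open>H\<close> as the source, because there the axioms are known and the isomorphism can be inverted.
\<close>
lemma embed_reduction_extension_iso: "symp_iso H (reduction (extension H))"
proof -
  let ?R = "reduction (extension H)"
  let ?f = "\<lambda>x. (x, 0)"
  have "bij_betw ?f (car H) (car ?R)"
    by (rule bij_betw_byWitness[where f' = fst]) (auto simp: reduction_def extension_def)
  moreover have "linear_on (scl H) (scl ?R) (car H) ?f"
    by (auto simp: linear_on_def reduction_def extension_simps prod_scale(2)[OF vs.vector_space_axioms])
  moreover have "?f (mul H x y) = mul ?R (?f x) (?f y)" for x y
    by (simp add: reduction_def extension_simps)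
  ultimately have "alg_iso H ?R ?f" by (simp add: alg_iso_def)
  moreover have "sform ?R (?f x) (?f y) = sform H x y" for x y
    by (simp add: reduction_def extension_simps)
  moreover have "?f (der H x) = der ?R (?f x)" if "x \<in> car H" for x
    using that by (simp add: reduction_def extension_simps reeb_extension)
  ultimately show ?thesis unfolding symp_iso_def by blast
qed

lemma reduction_extension_iso: "symp_iso (reduction (extension H)) H"
  by (rule symp_iso_sym[OF embed_reduction_extension_iso])

text \<open>
  In this normal form the Jacobi sum of the extension consists of the one of \<open>H\<close> and of terms with a
  coefficient \<open>a\<close>, \<open>b\<close> or \<open>c\<close>, which cancel cyclically. The terms with two coefficients have already
  disappeared by \<open>D\<^sup>2 = 0\<close>.
\<close>
lemma extension_mul_mul:
  assumes "x \<in> car H" "y \<in> car H" "z \<in> car H"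
  shows "mul (extension H) (x, a) (mul (extension H) (y, b) (z, c)) =
    (mul H x (mul H y z) + scl H b (mul H x (der H z)) + scl H c (mul H x (der H y))
       - scl H a (mul H z (der H y)) - scl H a (mul H y (der H z)), 0)"
  using assms
  by (simp add: extension_simps mul_add_right mul_scl_right der_add der_scl der_mul der_square
      vs.scale_right_distrib vs.scale_right_diff_distrib mul_commute[of "der H y" z])

lemma extension_jj_algebra: "jj_algebra (2 * n + 1) (extension H)"
proof -
  let ?E = "extension H"
  note scale = prod_scale[OF vs.vector_space_axioms]
  interpret p: vector_space "module_prod.scale (scl H) (*)" by (rule scale(1))
  let ?U = "(\<lambda>x. (x, 0)) ` car H"
  have "has_dim (module_prod.scale (scl H) (*)) ?U (2 * n)"
    by (rule has_dim_image[OF has_dim scale(1)]) (auto simp: linear_on_def scale(2) inj_on_def)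
  then have dim: "has_dim (module_prod.scale (scl H) (*)) (car H \<times> UNIV) (Suc (2 * n))"
  proof (rule has_dim_add_line[where x = "(0, 1)"])
    show "p.subspace (car H \<times> UNIV)"
      by (rule p.subspaceI) (auto simp: scale(2) zero_prod_def)
    show "\<exists>c. v - module_prod.scale (scl H) (*) c (0, 1) \<in> ?U" if "v \<in> car H \<times> UNIV" for v
      using that by (intro exI[of _ "snd v"]) (auto simp: scale(2))
  qed auto
  show ?thesis
  proof
    show "has_dim (scl ?E) (car ?E) (2 * n + 1)"
      using dim by (simp add: extension_simps)
    show "bilinear_on (scl ?E) (scl ?E) (car ?E) (mul ?E)"
      unfolding bilinear_on_def linear_on_def
      by (auto simp: extension_simps scale(2) mul_add_left mul_add_right mul_scl_left mul_scl_right
          der_add der_scl vs.scale_left_distrib vs.scale_right_distrib vs.scale_scale mult.commute algebra_simps)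
  next
    fix p q assume "p \<in> car ?E" "q \<in> car ?E"
    then show "mul ?E p q \<in> car ?E" "mul ?E p q = mul ?E q p"
      by (auto simp: extension_simps mul_commute algebra_simps)
  next
    fix p q r assume pqr: "p \<in> car ?E" "q \<in> car ?E" "r \<in> car ?E"
    obtain x a y b z c where e: "p = (x, a)" "q = (y, b)" "r = (z, c)" by (cases p, cases q, cases r)
    have xyz: "x \<in> car H" "y \<in> car H" "z \<in> car H" using pqr e by (auto simp: extension_simps)
    show "mul ?E p (mul ?E q r) + mul ?E q (mul ?E r p) + mul ?E r (mul ?E p q) = 0"
      unfolding e extension_mul_mul[OF xyz] extension_mul_mul[OF xyz(2,3,1)]
        extension_mul_mul[OF xyz(3,1,2)]
      using jacobi[OF xyz] by (simp add: zero_prod_def algebra_simps)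
  qed
qed

text \<open>
  On \<open>\<xi>, e\<^sub>1, f\<^sub>1, \<dots>, e\<^sub>n, f\<^sub>n\<close> with a Darboux basis of \<open>H\<close> the volume form takes the value \<open>n!\<close>, which is
  nonzero by the assumption on the characteristic. Closedness of \<open>\<omega>\<close> amounts to closedness on
  \<open>H\<close> and to \<open>D\<close> being self-adjoint.
\<close>
lemma extension_cosymplectic:
  assumes char: "CHAR('k) \<noteq> 2" "CHAR('k) = 0 \<or> n < CHAR('k)"
  shows "cosymplectic_jj_algebra n (extension H)"
proof -
  let ?E = "extension H"
  note scale = prod_scale[OF vs.vector_space_axioms]
  interpret E: jj_algebra "2 * n + 1" ?E by (rule extension_jj_algebra)
  interpret w: skew_space "scl H" "car H" "sform H" using skew_space[OF sform_skew char(1)] .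
  obtain vs where vs: "length vs = 2 * n" "set vs \<subseteq> car H"
      "wedge_power2 (form2 (sform H)) n vs = of_nat (fact n)"
    using w.nondegenerate_imp_volume[OF has_dim] sform_nondegenerate by blast
  show ?thesis
  proof
    show "linear_on (scl ?E) (*) (car ?E) (alpha ?E)"
      by (auto simp: linear_on_def extension_simps scale(2))
    show "skew_form ?E (omega ?E)"
      unfolding skew_form_def
    proof
      show "bilinear_on (scl ?E) (*) (car ?E) (omega ?E)"
        unfolding bilinear_on_def linear_on_def by (auto simp: extension_simps scale(2) sform_linear)
      show "\<forall>p\<in>car ?E. \<forall>q\<in>car ?E. omega ?E p q = - omega ?E q p"
        by (clarsimp simp: extension_simps) (rule sform_swap)
    qed
    show "closed_form ?E (omega ?E)"
      unfolding closed_form_def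
    proof (intro ballI)
      fix p q r assume pqr: "p \<in> car ?E" "q \<in> car ?E" "r \<in> car ?E"
      obtain x a y b z c where e: "p = (x, a)" "q = (y, b)" "r = (z, c)" by (cases p, cases q, cases r)
      have xyz: "x \<in> car H" "y \<in> car H" "z \<in> car H" using pqr e by (auto simp: extension_simps)
      have D: "sform H (der H v) u = - sform H (der H u) v" if "u \<in> car H" "v \<in> car H" for u v
        using der_sform[OF that] sform_swap[of u "der H v"] that by simp
      have "sform H (mul H x y) z + sform H (mul H z x) y + sform H (mul H y z) x = 0"
        using sform_closed xyz unfolding closed_form_def by blast
      then show "omega ?E (mul ?E p q) r + omega ?E (mul ?E r p) q + omega ?E (mul ?E q r) p = 0"
        using xyz D[OF xyz(1,2)] D[OF xyz(1,3)] D[OF xyz(2,3)]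
        by (simp add: e extension_simps sform_linear algebra_simps)
    qed
    let ?us = "(0, 1) # map (\<lambda>x. (x, 0)) vs"
    have "wedge 1 (2 * n) (form1 (alpha ?E)) (wedge_power2 (form2 (omega ?E)) n) ?us
        = wedge_power2 (form2 (omega ?E)) n (map (\<lambda>x. (x, 0)) vs)"
      using vs(1) by (subst wedge_1_Cons) (auto simp: extension_simps)
    also have "\<dots> = of_nat (fact n)"
      using vs wedge_power2_map[where S = "car H" and w = "sform H" and w' = "omega ?E"
          and f = "\<lambda>x. (x, 0)" and vs = vs and n = n]
      by (simp add: extension_simps)
    finally show "\<exists>us. length us = 2 * n + 1 \<and> set us \<subseteq> car ?E \<and>
        wedge 1 (2 * n) (form1 (alpha ?E)) (wedge_power2 (form2 (omega ?E)) n) us \<noteq> 0"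
      using vs(1,2) of_nat_fact_neq_0[OF char(2)]
      by (intro exI[of _ ?us]) (auto simp: extension_simps)
  next
    fix p q show "alpha ?E (mul ?E p q) = 0"
      by (cases p, cases q) (simp add: extension_simps)
  qed
qed

lemma cosymp_iso_extension:
  assumes iso: "symp_iso H H'" and "vector_space (scl H')"
  shows "cosymp_iso (extension H) (extension H')"
proof -
  obtain f where f: "alg_iso H H' f"
    "\<And>x y. x \<in> car H \<Longrightarrow> y \<in> car H \<Longrightarrow> sform H' (f x) (f y) = sform H x y"
    "\<And>x. x \<in> car H \<Longrightarrow> f (der H x) = der H' (f x)"
    using iso unfolding symp_iso_def by metis
  let ?E = "extension H" and ?E' = "extension H'"
  let ?F = "\<lambda>(x, a). (f x, a)"
  have "bij_betw ?F (car ?E) (car ?E')"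
    using alg_isoD(1)[OF f(1)]
    by (auto simp: extension_simps bij_betw_def inj_on_def image_iff alg_isoD(3)[OF f(1), symmetric])
  moreover have "linear_on (scl ?E) (scl ?E') (car ?E) ?F"
    using alg_isoD(4,5)[OF f(1)]
    by (auto simp: linear_on_def extension_simps prod_scale(2)[OF vs.vector_space_axioms]
        prod_scale(2)[OF assms(2)])
  moreover have "?F (mul ?E p q) = mul ?E' (?F p) (?F q)" if "p \<in> car ?E" "q \<in> car ?E" for p q
    using that by (auto simp: extension_simps alg_isoD(4-6)[OF f(1)] f(3)[symmetric])
  ultimately have "alg_iso ?E ?E' ?F" by (simp add: alg_iso_def)
  moreover have "alpha ?E' (?F p) = alpha ?E p" for p
    by (cases p) (simp add: extension_simps)
  moreover have "omega ?E' (?F p) (?F q) = omega ?E p q" if "p \<in> car ?E" "q \<in> car ?E" for p q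
    using that by (auto simp: extension_simps f(2))
  ultimately show ?thesis unfolding cosymp_iso_def by blast
qed

lemma symp_structure_on:
  assumes "has_dim t W (2 * n)"
  shows "\<exists>H'\<in>symp_structures n t W. symp_iso H H'"
proof -
  obtain f where f: "bij_betw f (car H) W" "linear_on (scl H) t (car H) f"
    using has_dim_isomorphic[OF has_dim assms] by blast
  define g where "g = inv_into (car H) f"
  have g: "g (f x) = x" if "x \<in> car H" for x
    using that f(1) by (simp add: g_def bij_betw_def)
  define H' where "H' = \<lparr>scl = t, car = W, mul = (\<lambda>x y. f (mul H (g x) (g y))),
    sform = (\<lambda>x y. sform H (g x) (g y)), der = (\<lambda>x. f (der H (g x)))\<rparr>"
  have "alg_iso H H' f" using f by (simp add: alg_iso_def H'_def g)
  then have iso: "symp_iso H H'"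
    unfolding symp_iso_def by (intro exI[of _ f]) (simp add: H'_def g)
  moreover have "symplectic_jj_algebra_der n H'"
    using assms by (intro symplectic_transport[OF iso]) (simp add: H'_def has_dim_def)
  ultimately show ?thesis by (intro bexI[of _ H']) (simp_all add: symp_structures_def H'_def)
qed

end

lemma (in cosymplectic_jj_algebra) cosymp_structure_on:
  assumes "has_dim s V (2 * n + 1)"
  shows "\<exists>J'\<in>cosymp_structures n s V. cosymp_iso J J'"
proof -
  obtain f where f: "bij_betw f (car J) V" "linear_on (scl J) s (car J) f"
    using has_dim_isomorphic[OF has_dim assms] by blast
  define g where "g = inv_into (car J) f"
  have g: "g (f x) = x" if "x \<in> car J" for x
    using that f(1) by (simp add: g_def bij_betw_def)
  define J' where "J' = \<lparr>scl = s, car = V, mul = (\<lambda>x y. f (mul J (g x) (g y))),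
    alpha = (\<lambda>x. alpha J (g x)), omega = (\<lambda>x y. omega J (g x) (g y))\<rparr>"
  have "alg_iso J J' f" using f by (simp add: alg_iso_def J'_def g)
  then have iso: "cosymp_iso J J'"
    unfolding cosymp_iso_def by (intro exI[of _ f]) (simp add: J'_def g)
  moreover have "cosymplectic_jj_algebra n J'"
    using assms by (intro cosymplectic_transport[OF iso]) (simp add: J'_def has_dim_def)
  ultimately show ?thesis by (intro bexI[of _ J']) (simp_all add: cosymp_structures_def J'_def)
qed

section \<open>The correspondence\<close>

lemma symplectic_vector_space: "symplectic_jj_algebra_der n H \<Longrightarrow> vector_space (scl H)"
  by (simp add: symplectic_jj_algebra_der_def symplectic_jj_algebra_def jj_algebra_def has_dim_def)

text \<open>
  An isomorphism of the reductions extends by \<open>\<xi> \<mapsto> \<xi>'\<close>: pass through the extensions of the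
  reductions.
\<close>
lemma cosymp_iso_iff_reduction:
  fixes J :: "('k::field, 'v::ab_group_add) cosymp" and J' :: "('k, 'w::ab_group_add) cosymp"
  assumes char: "CHAR('k) \<noteq> 2"
    and J: "cosymplectic_jj_algebra n J" and J': "cosymplectic_jj_algebra n J'"
  shows "cosymp_iso J J' \<longleftrightarrow> symp_iso (reduction J) (reduction J')"
proof
  interpret J: cosymplectic_jj_algebra n J by fact
  interpret J': cosymplectic_jj_algebra n J' by fact
  interpret R: symplectic_jj_algebra_der n "reduction J" by (rule J.reduction_symplectic[OF char])
  show "symp_iso (reduction J) (reduction J')" if "cosymp_iso J J'"
    using that by (rule symp_iso_reduction[OF J.reeb_unique[OF char] J'.reeb_unique[OF char]])
  show "cosymp_iso J J'" if "symp_iso (reduction J) (reduction J')"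
  proof -
    have "cosymp_iso J (extension (reduction J))"
      by (rule cosymp_iso_sym[OF R.extension_jj_algebra J.extension_reduction_iso[OF char]])
    also have "cosymp_iso (extension (reduction J)) (extension (reduction J'))"
      using that symplectic_vector_space[OF J'.reduction_symplectic[OF char]]
      by (rule R.cosymp_iso_extension)
    also have "cosymp_iso (extension (reduction J')) J'"
      by (rule J'.extension_reduction_iso[OF char])
    finally show ?thesis .
  qed
qed

lemma symp_iso_iff_extension:
  assumes H: "symplectic_jj_algebra_der n H" and H': "symplectic_jj_algebra_der n H'"
  shows "symp_iso H H' \<longleftrightarrow> cosymp_iso (extension H) (extension H')"
proof
  interpret H: symplectic_jj_algebra_der n H by fact
  interpret H': symplectic_jj_algebra_der n H' by fact
  show "cosymp_iso (extension H) (extension H')" if "symp_iso H H'"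
    using that symplectic_vector_space[OF H'] by (rule H.cosymp_iso_extension)
  show "symp_iso H H'" if "cosymp_iso (extension H) (extension H')"
  proof -
    have "symp_iso H (reduction (extension H))" by (rule H.embed_reduction_extension_iso)
    also have "symp_iso (reduction (extension H)) (reduction (extension H'))"
      using that by (rule symp_iso_reduction[OF H.extension_reeb_unique H'.extension_reeb_unique])
    also have "symp_iso (reduction (extension H')) H'" by (rule H'.reduction_extension_iso)
    finally show ?thesis .
  qed
qed

text \<open>
  A symplectic algebra on \<open>W\<close> is hit because its extension can be moved to \<open>V\<close>, which has the right
  dimension; this is the step that needs the extension to have a nonzero volume form.
\<close>
lemma reduction_class_bij:
  fixes s :: "'k::field \<Rightarrow> 'v::ab_group_add \<Rightarrow> 'v" and t :: "'k \<Rightarrow> 'w::ab_group_add \<Rightarrow> 'w"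
  assumes char: "CHAR('k) \<noteq> 2" "CHAR('k) = 0 \<or> n < CHAR('k)"
    and V: "has_dim s V (2 * n + 1)" and W: "has_dim t W (2 * n)"
  shows "bij_betw (reduction_class n t W) (cosymp_classes n s V) (symp_classes n t W)"
proof -
  let ?S = "cosymp_structures n s V" and ?T = "symp_structures n t W"
  let ?P = "\<lambda>J H. symp_iso (reduction J) H"
  have S: "cosymplectic_jj_algebra n J" if "J \<in> ?S" for J
    using that by (simp add: cosymp_structures_def)
  have red: "symplectic_jj_algebra_der n (reduction J)" if "J \<in> ?S" for J
    using cosymplectic_jj_algebra.reduction_symplectic[OF S[OF that] char(1)] .
  have T: "symplectic_jj_algebra_der n H" if "H \<in> ?T" for H
    using that by (simp add: symp_structures_def)
  note symp_sym = symplectic_jj_algebra_der.symp_iso_sym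
  have rel: "cosymp_iso J J' \<longleftrightarrow> symp_iso H H'"
    if "J \<in> ?S" "J' \<in> ?S" "H \<in> ?T" "H' \<in> ?T" "?P J H" "?P J' H'" for J J' H H'
  proof -
    have "symp_iso (reduction J) (reduction J') \<longleftrightarrow> symp_iso H H'"
      using that(5,6) symp_sym[OF red[OF that(1)] that(5)] symp_sym[OF red[OF that(2)] that(6)]
      by (meson symp_iso_trans)
    then show ?thesis
      using cosymp_iso_iff_reduction[OF char(1) S[OF that(1)] S[OF that(2)]] by simp
  qed
  have left: "\<exists>H\<in>?T. ?P J H" if "J \<in> ?S" for J
    by (rule symplectic_jj_algebra_der.symp_structure_on[OF red[OF that] W])
  have right: "\<exists>J\<in>?S. ?P J H" if "H \<in> ?T" for H
  proof -
    interpret H: symplectic_jj_algebra_der n H by (rule T[OF that])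
    interpret E: cosymplectic_jj_algebra n "extension H" by (rule H.extension_cosymplectic[OF char])
    obtain J where J: "J \<in> ?S" "cosymp_iso (extension H) J"
      using E.cosymp_structure_on[OF V] by blast
    interpret J: cosymplectic_jj_algebra n J by (rule S[OF J(1)])
    have "cosymp_iso J (extension H)" by (rule cosymp_iso_sym[OF E.jj_algebra_axioms J(2)])
    then have "symp_iso (reduction J) (reduction (extension H))"
      by (rule symp_iso_reduction[OF J.reeb_unique[OF char(1)] H.extension_reeb_unique])
    then show ?thesis using H.reduction_extension_iso J(1) by (blast intro: symp_iso_trans)
  qed
  show ?thesis
    using bij_betw_quotients[of ?S ?T ?P cosymp_iso symp_iso, OF rel left right]
    unfolding cosymp_classes_def symp_classes_def reduction_class_def .
qed

theorem theorem3p1: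
  fixes n :: nat
  assumes "CHAR('k::field) \<noteq> 2" and "CHAR('k) \<noteq> 3"
  shows
    "(\<forall>J :: ('k, 'a::ab_group_add) cosymp. cosymplectic_jj_algebra n J \<longrightarrow>
        (\<exists>!\<xi>. is_reeb J \<xi>) \<and>
        symplectic_jj_algebra_der n (reduction J) \<and>
        cosymp_iso (extension (reduction J)) J) \<and>
     (\<forall>H :: ('k, 'c::ab_group_add) symp. symplectic_jj_algebra_der n H \<longrightarrow>
        (CHAR('k) = 0 \<or> n < CHAR('k) \<longrightarrow> cosymplectic_jj_algebra n (extension H)) \<and>
        symp_iso (reduction (extension H)) H) \<and>
     (\<forall>(J :: ('k, 'a) cosymp) (J' :: ('k, 'b::ab_group_add) cosymp).
        cosymplectic_jj_algebra n J \<and> cosymplectic_jj_algebra n J' \<longrightarrow>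
        (cosymp_iso J J' \<longleftrightarrow> symp_iso (reduction J) (reduction J'))) \<and>
     (\<forall>(H :: ('k, 'c) symp) (H' :: ('k, 'd::ab_group_add) symp).
        symplectic_jj_algebra_der n H \<and> symplectic_jj_algebra_der n H' \<longrightarrow>
        (symp_iso H H' \<longleftrightarrow> cosymp_iso (extension H) (extension H'))) \<and>
     (\<forall>(s :: 'k \<Rightarrow> 'a \<Rightarrow> 'a) V (t :: 'k \<Rightarrow> 'c \<Rightarrow> 'c) W.
        (CHAR('k) = 0 \<or> n < CHAR('k)) \<and> has_dim s V (2 * n + 1) \<and> has_dim t W (2 * n) \<longrightarrow>
        bij_betw (reduction_class n t W) (cosymp_classes n s V) (symp_classes n t W))"
proof (intro conjI allI impI)
  fix J :: "('k, 'a) cosymp" assume "cosymplectic_jj_algebra n J"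
  then interpret cosymplectic_jj_algebra n J .
  show "\<exists>!\<xi>. is_reeb J \<xi>" by (rule reeb_unique[OF assms(1)])
  show "symplectic_jj_algebra_der n (reduction J)" by (rule reduction_symplectic[OF assms(1)])
  show "cosymp_iso (extension (reduction J)) J" by (rule extension_reduction_iso[OF assms(1)])
next
  fix H :: "('k, 'c) symp" assume "symplectic_jj_algebra_der n H"
  then interpret symplectic_jj_algebra_der n H .
  show "cosymplectic_jj_algebra n (extension H)" if "CHAR('k) = 0 \<or> n < CHAR('k)"
    by (rule extension_cosymplectic[OF assms(1) that])
  show "symp_iso (reduction (extension H)) H" by (rule reduction_extension_iso)
qed (use cosymp_iso_iff_reduction[OF assms(1)] symp_iso_iff_extension
    reduction_class_bij[OF assms(1)] in blast)+

end
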